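(* There exist an irrational $\alpha\in\mathbb{T}$ and a continuous $\varphi:\mathbb{T}\to\mathbb{R}$ such that the homeomorphism $f=f_{\alpha,\varphi}:\mathbb{R}^2\to\mathbb{R}^2$ is topologically transitive (has a dense two-sided orbit) and such that, for each $(s_-,s_+)\in\{-,+\}^2$, the set $P^{s_-s_+}=\{re^{2\pi i\omega}: r>0,\ \omega\in D^{s_-s_+}(\alpha,\varphi)\}\subset\mathbb{R}^2$ is nonempty and has Hausdorff dimension at least $3/2$. Here every point of $P^{--}$ generates an orbit homoclinic to $0$ (i.e. $f^n(p)\to0$ as $n\to\pm\infty$), every point of $P^{++}$ generates a discrete orbit, and for every point of $P^{-+}$ or $P^{+-}$ one semi-orbit is attracted by $0$ while the other semi-orbit escapes to infinity.
   Context: $\mathbb{T}=\mathbb{R}/\mathbb{Z}$ and $\mathbb{R}^2$ is identified with $\mathbb{C}$. For continuous $\varphi:\mathbb{T}\to\mathbb{R}$, $f_{\alpha,\varphi}(re^{2\pi i\omega})=re^{\varphi(\omega)+2\pi i(\omega+\alpha)}$ for $r\ge0$, $\omega\in\mathbb{T}$. For $n\in\mathbb{Z}$: $\varphi^{(n)}(x)=\sum_{k=0}^{n-1}\varphi(x+k\alpha)$ for $n>0$, $\varphi^{(0)}=0$, $\varphi^{(n)}(x)=-\sum_{k=1}^{|n|}\varphi(x-k\alpha)$ for $n<0$. For $s_-,s_+\in\{-,+\}$, $D^{s_-s_+}(\alpha,\varphi)=\{x\in\mathbb{T}:\ \varphi^{(m)}(x)\to s_-\infty \text{ as } m\to-\infty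 \text{ and } \varphi^{(m)}(x)\to s_+\infty\text{ as }m\to+\infty\}$. A discrete orbit is one all of whose points are isolated in the orbit. *)

theory Defs
  imports "HOL-Analysis.Analysis"
begin

section \<open>Skew maps of the plane over circle rotations\<close>

text \<open>
  The circle \<open>\<real>/\<int>\<close> is represented by its universal cover: a function on it is a 1-periodic
  function on \<^typ>\<open>real\<close>, and its elements and subsets are represented by real numbers
  and by 1-periodic sets of reals. In particular \<open>\<alpha>\<close> below is a real representative of
  the rotation angle.
\<close>

definition circle_fun :: "(real \<Rightarrow> real) \<Rightarrow> bool" where
  "circle_fun \<phi> \<longleftrightarrow> continuous_on UNIV \<phi> \<and> (\<forall>x. \<phi> (x + 1) = \<phi> x)"

text \<open>
  \<open>Arg z / (2 * pi)\<close> is one real representative of the angle of \<open>z\<close>; for a 1-periodic \<open>\<phi>\<close>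
  its choice is irrelevant, as the lemma \<open>skew_map_polar\<close> shows.
\<close>

definition skew_map :: "real \<Rightarrow> (real \<Rightarrow> real) \<Rightarrow> complex \<Rightarrow> complex" where
  "skew_map \<alpha> \<phi> z =
     (let \<omega> = Arg z / (2 * pi)
      in complex_of_real (cmod z * exp (\<phi> \<omega>)) * cis (2 * pi * (\<omega> + \<alpha>)))"

lemma skew_map_polar:
  assumes "\<And>x. \<phi> (x + 1) = \<phi> x" "r \<ge> 0"
  shows "skew_map \<alpha> \<phi> (complex_of_real r * cis (2 * pi * \<omega>)) =
         complex_of_real (r * exp (\<phi> \<omega>)) * cis (2 * pi * (\<omega> + \<alpha>))"
proof (cases "r = 0")
  case True
  then show ?thesis by (simp add: skew_map_def)
next
  case False
  with assms(2) have r: "r > 0" by simp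
  let ?z = "complex_of_real r * cis (2 * pi * \<omega>)"
  define t where "t = Arg ?z / (2 * pi)"
  have norm_z: "cmod ?z = r" using r by (simp add: norm_mult)
  have "complex_of_real r * cis (2 * pi * t) = ?z"
    using rcis_cmod_Arg[of ?z] norm_z by (simp add: rcis_def t_def)
  then have c: "cis (2 * pi * t) = cis (2 * pi * \<omega>)" using r by simp
  then have "sin (2 * pi * t) = sin (2 * pi * \<omega>) \<and> cos (2 * pi * t) = cos (2 * pi * \<omega>)"
    by (simp add: complex_eq_iff)
  then obtain n :: int where "2 * pi * t = 2 * pi * \<omega> + 2 * pi * n"
    using sin_cos_eq_iff by blast
  then have "2 * pi * t = 2 * pi * (\<omega> + of_int n)" by (simp add: algebra_simps)
  then have n: "t = \<omega> + of_int n" by simp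
  interpret periodic_fun_simple' \<phi> by standard (rule assms(1))
  have "\<phi> t = \<phi> \<omega>" unfolding n by (rule plus_of_int)
  moreover have "cis (2 * pi * (t + \<alpha>)) = cis (2 * pi * (\<omega> + \<alpha>))"
    using c by (simp add: distrib_left flip: cis_mult)
  ultimately show ?thesis
    using norm_z unfolding skew_map_def Let_def t_def by simp
qed

definition birkhoff_sum :: "real \<Rightarrow> (real \<Rightarrow> real) \<Rightarrow> int \<Rightarrow> real \<Rightarrow> real" where
  "birkhoff_sum \<alpha> \<phi> n x =
     (if n \<ge> 0 then \<Sum>k<nat n. \<phi> (x + real k * \<alpha>)
      else - (\<Sum>k=1..nat \<bar>n\<bar>. \<phi> (x - real k * \<alpha>)))"

datatype sign = Minus | Plus

primrec signed_infinity :: "sign \<Rightarrow> real filter" where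
  "signed_infinity Minus = at_bot"
| "signed_infinity Plus = at_top"

definition div_set :: "sign \<Rightarrow> sign \<Rightarrow> real \<Rightarrow> (real \<Rightarrow> real) \<Rightarrow> real set" where
  "div_set sm sp \<alpha> \<phi> =
     {x. filterlim (\<lambda>m. birkhoff_sum \<alpha> \<phi> m x) (signed_infinity sm) at_bot \<and>
         filterlim (\<lambda>m. birkhoff_sum \<alpha> \<phi> m x) (signed_infinity sp) at_top}"

definition planar_div_set :: "sign \<Rightarrow> sign \<Rightarrow> real \<Rightarrow> (real \<Rightarrow> real) \<Rightarrow> complex set" where
  "planar_div_set sm sp \<alpha> \<phi> =
     {complex_of_real r * cis (2 * pi * \<omega>) | r \<omega>. r > 0 \<and> \<omega> \<in> div_set sm sp \<alpha> \<phi>}"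

section \<open>Two-sided orbits\<close>

definition int_iterate :: "('a \<Rightarrow> 'a) \<Rightarrow> int \<Rightarrow> 'a \<Rightarrow> 'a" where
  "int_iterate f n = (if n \<ge> 0 then f ^^ nat n else inv f ^^ nat (- n))"

definition two_sided_orbit :: "('a \<Rightarrow> 'a) \<Rightarrow> 'a \<Rightarrow> 'a set" where
  "two_sided_orbit f p = range (\<lambda>n. int_iterate f n p)"

definition topologically_transitive :: "('a::topological_space \<Rightarrow> 'a) \<Rightarrow> bool" where
  "topologically_transitive f \<longleftrightarrow> (\<exists>p. closure (two_sided_orbit f p) = UNIV)"

section \<open>Hausdorff measure and dimension\<close>

text \<open>
  The value \<open>(diam U)\<^sup>s\<close> with the usual conventions for \<open>s = 0\<close>: nonempty sets count 1 and
  the empty set counts 0. (In HOL, \<open>0 powr 0 = 0\<close>.) Only used for bounded \<open>U\<close>,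
  as \<^const>\<open>diameter\<close> is meaningless otherwise.
\<close>

definition diam_powr :: "real \<Rightarrow> 'a::metric_space set \<Rightarrow> ennreal" where
  "diam_powr s U =
     (if U = {} then 0 else if s = 0 then 1 else ennreal (diameter U powr s))"

definition hausdorff_premeasure :: "real \<Rightarrow> real \<Rightarrow> 'a::metric_space set \<Rightarrow> ennreal" where
  "hausdorff_premeasure s \<delta> A =
     (INF U\<in>{U :: nat \<Rightarrow> 'a set.
               A \<subseteq> (\<Union>i. U i) \<and> (\<forall>i. bounded (U i) \<and> diameter (U i) \<le> \<delta>)}.
        \<Sum>i. diam_powr s (U i))"

definition hausdorff_measure :: "real \<Rightarrow> 'a::metric_space set \<Rightarrow> ennreal" where
  "hausdorff_measure s A = (SUP \<delta>\<in>{0<..}. hausdorff_premeasure s \<delta> A)"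

definition hausdorff_dim :: "'a::metric_space set \<Rightarrow> ennreal" where
  "hausdorff_dim A = (INF s\<in>{s. s \<ge> 0 \<and> hausdorff_measure s A = 0}. ennreal s)"

end

theory Submission
  imports Defs
begin

text \<open>
  The angle is \<open>\<alpha> = \<Sum>\<^sub>j 1 / q\<^sub>j\<^sub>+\<^sub>1\<close> with \<open>q\<^sub>j\<^sub>+\<^sub>1 = q\<^sub>j \<tau>\<^sub>j\<close>, so that \<open>q\<^sub>j \<alpha>\<close> exceeds an integer by some
  \<open>\<eta>\<^sub>j \<approx> 1 / \<tau>\<^sub>j\<close>, and \<open>\<phi> x = \<Sum>\<^sub>j E\<^sub>j (h (q\<^sub>j x + \<eta>\<^sub>j) - h (q\<^sub>j x))\<close> for a fixed Lipschitz wave \<open>h\<close> of period 1.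
  The Birkhoff sums telescope to \<open>\<Sum>\<^sub>j E\<^sub>j (h (q\<^sub>j x + m \<eta>\<^sub>j) - h (q\<^sub>j x))\<close>. As \<open>E\<^sub>j\<close> grows while \<open>E\<^sub>j / \<tau>\<^sub>j\<close>
  decays geometrically, the sign of this at times \<open>m\<close> between \<open>\<tau>\<^sub>j\<^sub>-\<^sub>1\<close> and \<open>\<tau>\<^sub>j\<close> is decided by level \<open>j\<close>.
  The wave has a peak, a valley, a rising and a falling ramp; the points \<open>x\<close> for which all
  \<open>q\<^sub>j x\<close> are close modulo 1 to one of these four phases lie in the corresponding set
  \<open>D\<close>. Closeness means up to a fixed constant while \<open>\<tau>\<^sub>j \<rightarrow> \<infinity>\<close>, so these points contain
  a Cantor set onto which the unit interval is mapped with an inverse that is Hoelder of exponent 1/2,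
  and the planar sets have dimension at least 3/2.
\<close>

section \<open>Skew maps\<close>

lemma birkhoff_sum_0 [simp]: "birkhoff_sum \<alpha> \<phi> 0 x = 0"
  by (simp add: birkhoff_sum_def)

text \<open>One recursion covers both branches of the definition. The delicate case is
  \<open>m = -1\<close>, where the step leads from the negative branch to the empty sum at time
  0.\<close>

lemma birkhoff_sum_add_1:
  "birkhoff_sum \<alpha> \<phi> (m + 1) x = birkhoff_sum \<alpha> \<phi> m x + \<phi> (x + of_int m * \<alpha>)"
proof (cases "m \<ge> 0")
  case True
  then have "nat (m + 1) = Suc (nat m)" by simp
  with True show ?thesis by (simp add: birkhoff_sum_def)
next
  case False
  define k where "k = nat (- m - 1)"
  have m: "m = - int (Suc k)" using False by (simp add: k_def)
  show ?thesis
  proof (cases k)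
    case 0
    then show ?thesis using m by (simp add: birkhoff_sum_def)
  next
    case (Suc j)
    have a: "m + 1 = - int (Suc j)" using m Suc by simp
    have b: "nat \<bar>m + 1\<bar> = Suc j" "nat \<bar>m\<bar> = Suc (Suc j)" "\<not> m + 1 \<ge> 0"
      unfolding a using m Suc by auto
    have c: "of_int m = - real (Suc (Suc j))" using m Suc by simp
    show ?thesis
      unfolding birkhoff_sum_def b c using b(3) False by (simp add: algebra_simps)
  qed
qed

text \<open>The recursion determines a two-sided sequence from its value at 0. Closed formulas for
  Birkhoff sums are verified through it, without splitting by the sign of the time.\<close>

lemma birkhoff_sum_unique:
  assumes "W 0 = 0" and "\<And>m. W (m + 1) = W m + \<phi> (x + of_int m * \<alpha>)"
  shows "birkhoff_sum \<alpha> \<phi> m x = W m"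
proof (induction m rule: int_induct[where k = 0])
  case base
  then show ?case by (simp add: assms)
next
  case (step1 i)
  then show ?case by (simp add: assms birkhoff_sum_add_1)
next
  case (step2 i)
  then show ?case
    using birkhoff_sum_add_1[of \<alpha> \<phi> "i - 1" x] assms(2)[of "i - 1"] by simp
qed

lemma circle_fun_periodic_int:
  assumes "circle_fun \<phi>"
  shows "\<phi> (x + of_int n) = \<phi> x"
proof -
  interpret periodic_fun_simple' \<phi>
    by standard (use assms in \<open>auto simp: circle_fun_def\<close>)
  show ?thesis by (rule plus_of_int)
qed

lemma circle_fun_bounded:
  assumes "circle_fun \<phi>"
  obtains M where "\<And>x. \<bar>\<phi> x\<bar> \<le> M"
proof -
  have "compact (\<phi> ` {0..1})"
    using assms by (intro compact_continuous_image) (auto simp: circle_fun_def intro: continuous_on_subset)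
  then have "bounded (\<phi> ` {0..1})" by (rule compact_imp_bounded)
  then obtain M where "\<forall>y \<in> \<phi> ` {0..1}. norm y \<le> M"
    unfolding bounded_iff by (elim exE)
  then have M: "\<And>x. x \<in> {0..1} \<Longrightarrow> norm (\<phi> x) \<le> M" by blast
  have "\<bar>\<phi> x\<bar> \<le> M" for x
    using M[of "frac x"] circle_fun_periodic_int[OF assms, of "frac x" "\<lfloor>x\<rfloor>"]
    by (simp add: frac_def less_imp_le frac_lt_1)
       (metis frac_def frac_lt_1 less_imp_le)
  then show thesis by (rule that)
qed

section \<open>Continuity, inverse and iterates of the skew map\<close>

lemma polar_coordinates_exist:
  obtains r \<omega> where "r \<ge> 0" "z = complex_of_real r * cis (2 * pi * \<omega>)"
proof
  show "z = complex_of_real (cmod z) * cis (2 * pi * (Arg z / (2 * pi)))"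
    using rcis_cmod_Arg[of z] by (simp add: rcis_def)
qed simp

text \<open>\<open>Arg\<close> jumps across the negative real axis, but by an integer number of
  turns, which the periodic \<phi> does not see. At the origin, boundedness of \<phi> gives
  continuity.\<close>

lemma continuous_skew_map:
  assumes "circle_fun \<phi>"
  shows "continuous_on UNIV (skew_map \<alpha> \<phi>)"
proof -
  define \<psi> where "\<psi> z = \<phi> (Arg z / (2 * pi))" for z
  have f: "skew_map \<alpha> \<phi> z = z * cis (2 * pi * \<alpha>) * complex_of_real (exp (\<psi> z))" for z
  proof -
    have "z = complex_of_real (cmod z) * cis (Arg z)"
      using rcis_cmod_Arg[of z] by (simp add: rcis_def)
    then show ?thesis
      by (simp add: skew_map_def Let_def \<psi>_def distrib_left flip: cis_mult)
  qed
  have cont_\<phi>: "isCont \<phi> x" for x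
    using assms by (simp add: circle_fun_def continuous_on_eq_continuous_at)
  have cont_pos: "isCont \<psi> z" if "z \<notin> \<real>\<^sub>\<le>\<^sub>0" for z
  proof -
    have "isCont (\<lambda>z. Arg z / (2 * pi)) z"
      using continuous_at_Arg[OF that] by (intro isCont_divide continuous_const) auto
    then show ?thesis unfolding \<psi>_def by (rule isCont_o2) (rule cont_\<phi>)
  qed
  \<comment> \<open>Measuring the angle from the opposite ray moves the branch cut away from the
    negative axis.\<close>
  have \<psi>_alt: "\<psi> z = \<phi> (Arg (- z) / (2 * pi) + 1 / 2)" if "z \<noteq> 0" for z
  proof -
    have "cis (Arg z) = - cis (Arg (- z))"
      using that by (simp add: cis_Arg)
    also have "\<dots> = cis (Arg (- z) + pi)" by (simp flip: cis_mult)
    finally have "sin (Arg z) = sin (Arg (- z) + pi) \<and> cos (Arg z) = cos (Arg (- z) + pi)"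
      by (simp add: complex_eq_iff)
    then obtain n :: int where n: "Arg z = Arg (- z) + pi + 2 * pi * n"
      using sin_cos_eq_iff by blast
    have "Arg z / (2 * pi) = (Arg (- z) / (2 * pi) + 1 / 2) + of_int n"
      unfolding n by (simp add: field_simps)
    then show ?thesis
      unfolding \<psi>_def by (simp only: circle_fun_periodic_int[OF assms])
  qed
  have cont_nonzero: "isCont \<psi> z" if "z \<noteq> 0" for z
  proof (cases "z \<in> \<real>\<^sub>\<le>\<^sub>0")
    case True
    then have "- z \<notin> \<real>\<^sub>\<le>\<^sub>0"
      using that by (auto simp: complex_nonpos_Reals_iff complex_eq_iff)
    then have "isCont (\<lambda>z. Arg (- z)) z"
      by (rule isCont_o2[of z uminus Arg, OF isCont_minus[OF continuous_ident] continuous_at_Arg])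
    then have "isCont (\<lambda>z. Arg (- z) / (2 * pi) + 1 / 2) z"
      by (intro isCont_add isCont_divide continuous_const) auto
    then have "isCont (\<lambda>z. \<phi> (Arg (- z) / (2 * pi) + 1 / 2)) z"
      by (rule isCont_o2) (rule cont_\<phi>)
    moreover have "eventually (\<lambda>w. \<psi> w = \<phi> (Arg (- w) / (2 * pi) + 1 / 2)) (nhds z)"
      using t1_space_nhds[OF that] by eventually_elim (rule \<psi>_alt)
    ultimately show ?thesis by (subst isCont_cong)
  qed (rule cont_pos)
  obtain M where M: "\<And>x. \<bar>\<phi> x\<bar> \<le> M" using circle_fun_bounded[OF assms] by blast
  have "isCont (skew_map \<alpha> \<phi>) z" for z
  proof (cases "z = 0")
    case False
    then have "isCont (\<lambda>z. z * cis (2 * pi * \<alpha>) * complex_of_real (exp (\<psi> z))) z"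
      by (intro continuous_intros cont_nonzero)
    then show ?thesis by (simp add: f[abs_def])
  next
    case True
    have "((\<lambda>z. z * cis (2 * pi * \<alpha>) * complex_of_real (exp (\<psi> z))) \<longlongrightarrow> 0) (at 0)"
    proof (rule Lim_null_comparison)
      show "eventually (\<lambda>z. norm (z * cis (2 * pi * \<alpha>) * complex_of_real (exp (\<psi> z))) \<le> norm z * exp M) (at 0)"
        using M by (intro always_eventually) (auto simp: norm_mult \<psi>_def abs_le_iff intro!: mult_left_mono)
      show "((\<lambda>z::complex. norm z * exp M) \<longlongrightarrow> 0) (at 0)"
        by (auto intro!: tendsto_eq_intros)
    qed
    then show ?thesis by (simp add: True isCont_def f[abs_def])
  qed
  then show ?thesis by (simp add: continuous_at_imp_continuous_on)
qed

text \<open>The inverse of a skew map is again a skew map: it rotates by \<open>-\<alpha>\<close>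
  and undoes the scaling applied at the preimage angle.\<close>

lemma circle_fun_inverse_cocycle:
  assumes "circle_fun \<phi>"
  shows "circle_fun (\<lambda>x. - \<phi> (x - \<alpha>))"
proof -
  have "\<phi> (x + 1 - \<alpha>) = \<phi> (x - \<alpha>)" for x
    using circle_fun_periodic_int[OF assms, of "x - \<alpha>" 1] by (simp add: algebra_simps)
  moreover have "continuous_on UNIV (\<lambda>x. - \<phi> (x - \<alpha>))"
    using assms unfolding circle_fun_def
    by (auto intro!: continuous_intros continuous_on_compose2[of UNIV \<phi>])
  ultimately show ?thesis by (simp add: circle_fun_def)
qed

lemma skew_map_right_inverse:
  assumes "circle_fun \<phi>"
  shows "skew_map \<alpha> \<phi> (skew_map (- \<alpha>) (\<lambda>x. - \<phi> (x - \<alpha>)) z) = z"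
proof -
  obtain r \<omega> where r: "r \<ge> 0" and z: "z = complex_of_real r * cis (2 * pi * \<omega>)"
    by (rule polar_coordinates_exist)
  have 1: "\<phi> (x + 1) = \<phi> x" "- \<phi> (x + 1 - \<alpha>) = - \<phi> (x - \<alpha>)" for x
    using assms circle_fun_inverse_cocycle[OF assms, of \<alpha>] by (auto simp: circle_fun_def)
  have "skew_map (- \<alpha>) (\<lambda>x. - \<phi> (x - \<alpha>)) z =
      complex_of_real (r * exp (- \<phi> (\<omega> - \<alpha>))) * cis (2 * pi * (\<omega> + - \<alpha>))"
    unfolding z by (rule skew_map_polar) (use 1 r in auto)
  also have "skew_map \<alpha> \<phi> \<dots> =
      complex_of_real (r * exp (- \<phi> (\<omega> - \<alpha>)) * exp (\<phi> (\<omega> + - \<alpha>))) * cis (2 * pi * (\<omega> + - \<alpha> + \<alpha>))"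
    by (rule skew_map_polar) (use 1 r in auto)
  also have "\<dots> = z" by (simp add: z exp_minus)
  finally show ?thesis .
qed

text \<open>Passing from \<alpha>, \<phi> to the inverse data is an involution, so the right-inverse
  law for the inverse data is the left-inverse law.\<close>

lemma skew_map_left_inverse:
  assumes "circle_fun \<phi>"
  shows "skew_map (- \<alpha>) (\<lambda>x. - \<phi> (x - \<alpha>)) (skew_map \<alpha> \<phi> z) = z"
  using skew_map_right_inverse[OF circle_fun_inverse_cocycle[OF assms, of \<alpha>], of "- \<alpha>" z] by simp

lemma inv_skew_map:
  assumes "circle_fun \<phi>"
  shows "inv (skew_map \<alpha> \<phi>) = skew_map (- \<alpha>) (\<lambda>x. - \<phi> (x - \<alpha>))"
  using skew_map_left_inverse[OF assms] skew_map_right_inverse[OF assms]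
  by (intro inv_unique_comp) auto

lemma homeomorphism_skew_map:
  assumes "circle_fun \<phi>"
  shows "homeomorphism UNIV UNIV (skew_map \<alpha> \<phi>) (inv (skew_map \<alpha> \<phi>))"
  unfolding inv_skew_map[OF assms]
  by (rule homeomorphismI)
     (use assms in \<open>auto simp: skew_map_left_inverse skew_map_right_inverse
        intro: continuous_skew_map circle_fun_inverse_cocycle\<close>)

text \<open>In polar coordinates the two-sided iterates are a rotation together with the exponential
  of a Birkhoff sum, which reduces the behaviour of orbits to that of Birkhoff sums.\<close>

lemma int_iterate_skew_map:
  assumes "circle_fun \<phi>" "r \<ge> 0"
  shows "int_iterate (skew_map \<alpha> \<phi>) m (complex_of_real r * cis (2 * pi * \<omega>)) =
    complex_of_real (r * exp (birkhoff_sum \<alpha> \<phi> m \<omega>)) * cis (2 * pi * (\<omega> + of_int m * \<alpha>))"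
proof -
  let ?p = "complex_of_real r * cis (2 * pi * \<omega>)"
  let ?P = "\<lambda>m. complex_of_real (r * exp (birkhoff_sum \<alpha> \<phi> m \<omega>)) * cis (2 * pi * (\<omega> + of_int m * \<alpha>))"
  have step: "skew_map \<alpha> \<phi> (?P m) = ?P (m + 1)" for m
  proof -
    have "skew_map \<alpha> \<phi> (?P m) = complex_of_real (r * exp (birkhoff_sum \<alpha> \<phi> m \<omega>) * exp (\<phi> (\<omega> + of_int m * \<alpha>)))
        * cis (2 * pi * (\<omega> + of_int m * \<alpha> + \<alpha>))"
      by (rule skew_map_polar) (use assms in \<open>auto simp: circle_fun_def\<close>)
    also have "\<omega> + of_int m * \<alpha> + \<alpha> = \<omega> + of_int (m + 1) * \<alpha>"
      by (simp add: algebra_simps)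
    also have "r * exp (birkhoff_sum \<alpha> \<phi> m \<omega>) * exp (\<phi> (\<omega> + of_int m * \<alpha>)) =
        r * exp (birkhoff_sum \<alpha> \<phi> (m + 1) \<omega>)"
      by (simp only: birkhoff_sum_add_1 exp_add mult.assoc)
    finally show ?thesis .
  qed
  have pos: "(skew_map \<alpha> \<phi> ^^ n) ?p = ?P (int n)" for n
  proof (induction n)
    case (Suc n)
    then show ?case using step[of "int n"] by (simp add: add.commute)
  qed simp
  have neg: "(inv (skew_map \<alpha> \<phi>) ^^ n) ?p = ?P (- int n)" for n
  proof (induction n)
    case (Suc n)
    have "inv (skew_map \<alpha> \<phi>) (?P (- int n)) = ?P (- int n - 1)"
      unfolding inv_skew_map[OF assms(1)]
      by (metis (no_types, lifting) step skew_map_left_inverse[OF assms(1)] diff_add_cancel)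
    moreover have "- int n - 1 = - int (Suc n)" by simp
    ultimately show ?case using Suc by (simp only: funpow.simps o_apply)
  qed simp
  show ?thesis
    using pos[of "nat m"] neg[of "nat (- m)"] by (auto simp: int_iterate_def)
qed

section \<open>Asymptotic behaviour of orbits\<close>

lemma cmod_int_iterate_skew_map:
  assumes "circle_fun \<phi>" "r \<ge> 0"
  shows "cmod (int_iterate (skew_map \<alpha> \<phi>) m (complex_of_real r * cis (2 * pi * \<omega>))) =
    r * exp (birkhoff_sum \<alpha> \<phi> m \<omega>)"
  using assms by (simp add: int_iterate_skew_map norm_mult)

lemma int_iterate_tendsto_0:
  assumes "circle_fun \<phi>" "r > 0" "filterlim (\<lambda>m. birkhoff_sum \<alpha> \<phi> m \<omega>) at_bot F"
  shows "((\<lambda>m. int_iterate (skew_map \<alpha> \<phi>) m (complex_of_real r * cis (2 * pi * \<omega>))) \<longlongrightarrow> 0) F"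
proof (rule tendsto_norm_zero_cancel)
  have "((\<lambda>m. exp (birkhoff_sum \<alpha> \<phi> m \<omega>)) \<longlongrightarrow> 0) F"
    by (rule filterlim_compose[OF exp_at_bot assms(3)])
  then have "((\<lambda>m. r * exp (birkhoff_sum \<alpha> \<phi> m \<omega>)) \<longlongrightarrow> 0) F"
    by (rule tendsto_mult_right_zero)
  then show "((\<lambda>m. cmod (int_iterate (skew_map \<alpha> \<phi>) m (complex_of_real r * cis (2 * pi * \<omega>)))) \<longlongrightarrow> 0) F"
    using assms by (simp add: cmod_int_iterate_skew_map)
qed

lemma int_iterate_at_infinity:
  assumes "circle_fun \<phi>" "r > 0" "filterlim (\<lambda>m. birkhoff_sum \<alpha> \<phi> m \<omega>) at_top F"
  shows "filterlim (\<lambda>m. int_iterate (skew_map \<alpha> \<phi>) m (complex_of_real r * cis (2 * pi * \<omega>))) at_infinity F"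
proof (rule filterlim_norm_at_top_imp_at_infinity)
  have "filterlim (\<lambda>m. exp (birkhoff_sum \<alpha> \<phi> m \<omega>)) at_top F"
    by (rule filterlim_compose[OF exp_at_top assms(3)])
  then have "filterlim (\<lambda>m. r * exp (birkhoff_sum \<alpha> \<phi> m \<omega>)) at_top F"
    using assms(2) by (intro filterlim_tendsto_pos_mult_at_top[OF tendsto_const])
  then show "filterlim (\<lambda>m. norm (int_iterate (skew_map \<alpha> \<phi>) m (complex_of_real r * cis (2 * pi * \<omega>)))) at_top F"
    using assms by (simp add: cmod_int_iterate_skew_map)
qed

text \<open>If the orbit escapes at both ends, only finitely many times lead into a given unit ball,
  so no orbit point is a limit of the orbit.\<close>

lemma discrete_two_sided_orbit:
  fixes p :: "'a::real_normed_vector"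
  assumes "filterlim (\<lambda>n. int_iterate f n p) at_infinity at_bot"
    and "filterlim (\<lambda>n. int_iterate f n p) at_infinity at_top"
  shows "discrete (two_sided_orbit f p)"
proof (rule discreteI)
  fix x assume x: "x \<in> two_sided_orbit f p"
  let ?g = "\<lambda>n. int_iterate f n p"
  let ?R = "norm x + 1"
  have R: "?R > 0" by (simp add: add_nonneg_pos)
  have "eventually (\<lambda>n. norm (?g n) \<ge> ?R) at_bot" "eventually (\<lambda>n. norm (?g n) \<ge> ?R) at_top"
    using assms R by (auto simp: filterlim_at_infinity[of 0])
  then obtain a b where ab: "\<And>n. n \<le> a \<Longrightarrow> norm (?g n) \<ge> ?R" "\<And>n. n \<ge> b \<Longrightarrow> norm (?g n) \<ge> ?R"
    by (auto simp: eventually_at_bot_linorder eventually_at_top_linorder)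
  have "ball x 1 \<inter> two_sided_orbit f p \<subseteq> ?g ` {a..b}"
  proof
    fix y assume "y \<in> ball x 1 \<inter> two_sided_orbit f p"
    then obtain n where n: "y = ?g n" "dist x y < 1" by (auto simp: two_sided_orbit_def)
    have "norm y < ?R"
      using n(2) norm_triangle_ineq2[of y x] by (simp add: dist_norm norm_minus_commute)
    then have "n \<in> {a..b}" using ab[of n] n(1) by fastforce
    with n show "y \<in> ?g ` {a..b}" by blast
  qed
  then have "finite (ball x 1 \<inter> two_sided_orbit f p)"
    by (rule finite_subset) simp
  then have "\<not> x islimpt two_sided_orbit f p"
    by (metis centre_in_ball islimpt_eq_infinite_ball zero_less_one inf_commute)
  with x show "x isolated_in two_sided_orbit f p"
    by (simp add: isolated_in_islimpt_iff)
qed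

section \<open>Topological transitivity\<close>

lemma circle_fun_birkhoff_sum:
  assumes "circle_fun \<phi>"
  shows "circle_fun (birkhoff_sum \<alpha> \<phi> m)"
proof -
  have cont: "continuous_on UNIV \<phi>" using assms by (simp add: circle_fun_def)
  have "continuous_on UNIV (\<lambda>x. \<phi> (x + c))" "continuous_on UNIV (\<lambda>x. \<phi> (x - c))" for c
    by (rule continuous_on_compose2[OF cont], intro continuous_intros, simp)+
  then have "continuous_on UNIV (birkhoff_sum \<alpha> \<phi> m)"
    unfolding birkhoff_sum_def[abs_def]
    by (cases "m \<ge> 0") (simp_all add: continuous_on_sum continuous_on_minus)
  moreover have "\<phi> (x + 1 + y) = \<phi> (x + y)" "\<phi> (x + 1 - y) = \<phi> (x - y)" for x y
    using circle_fun_periodic_int[OF assms, of "x + y" 1] circle_fun_periodic_int[OF assms, of "x - y" 1]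
    by (simp_all add: algebra_simps)
  then have "birkhoff_sum \<alpha> \<phi> m (x + 1) = birkhoff_sum \<alpha> \<phi> m x" for x
    by (simp only: birkhoff_sum_def)
  ultimately show ?thesis by (simp add: circle_fun_def)
qed

lemma birkhoff_sum_cocycle:
  "birkhoff_sum \<alpha> \<phi> m (x + of_int k * \<alpha>) = birkhoff_sum \<alpha> \<phi> (m + k) x - birkhoff_sum \<alpha> \<phi> k x"
proof (rule birkhoff_sum_unique)
  fix m
  have "birkhoff_sum \<alpha> \<phi> (m + 1 + k) x = birkhoff_sum \<alpha> \<phi> (m + k) x + \<phi> (x + of_int (m + k) * \<alpha>)"
    using birkhoff_sum_add_1[of \<alpha> \<phi> "m + k" x] by (simp add: ac_simps)
  moreover have "x + of_int (m + k) * \<alpha> = x + of_int k * \<alpha> + of_int m * \<alpha>"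
    by (simp add: algebra_simps)
  ultimately show "birkhoff_sum \<alpha> \<phi> (m + 1 + k) x - birkhoff_sum \<alpha> \<phi> k x =
    birkhoff_sum \<alpha> \<phi> (m + k) x - birkhoff_sum \<alpha> \<phi> k x + \<phi> (x + of_int k * \<alpha> + of_int m * \<alpha>)"
    by (simp only:)
qed simp

text \<open>By the cocycle identity, moving the point along its orbit shifts time and subtracts a
  constant; neither affects divergence.\<close>

lemma div_set_translate:
  assumes "circle_fun \<phi>" "x \<in> div_set sm sp \<alpha> \<phi>"
  shows "x + of_int k * \<alpha> + of_int n \<in> div_set sm sp \<alpha> \<phi>"
proof -
  have shift: "filterlim (\<lambda>m. birkhoff_sum \<alpha> \<phi> m (x + of_int k * \<alpha> + of_int n)) (signed_infinity s) F"
    if lim: "filterlim (\<lambda>m. birkhoff_sum \<alpha> \<phi> m x) (signed_infinity s) F"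
      and F: "filterlim (\<lambda>m. m + k) F F" for s F
  proof -
    have eq: "birkhoff_sum \<alpha> \<phi> m (x + of_int k * \<alpha> + of_int n) =
        - birkhoff_sum \<alpha> \<phi> k x + birkhoff_sum \<alpha> \<phi> (m + k) x" for m
      using circle_fun_periodic_int[OF circle_fun_birkhoff_sum[OF assms(1)]]
      by (simp add: birkhoff_sum_cocycle)
    have "filterlim (\<lambda>m. birkhoff_sum \<alpha> \<phi> (m + k) x) (signed_infinity s) F"
      by (rule filterlim_compose[OF lim F])
    then show ?thesis
      unfolding eq
      by (cases s) (simp_all only: signed_infinity.simps
          filterlim_tendsto_add_at_top_iff[OF tendsto_const] filterlim_tendsto_add_at_bot_iff[OF tendsto_const])
  qed
  have "filterlim (\<lambda>m. m + k) at_top at_top"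
    unfolding filterlim_at_top eventually_at_top_linorder
    by (metis diff_le_eq)
  moreover have "filterlim (\<lambda>m. m + k) at_bot at_bot"
    unfolding filterlim_at_bot eventually_at_bot_linorder
    by (metis le_diff_eq)
  ultimately show ?thesis
    using assms(2) shift by (simp add: div_set_def)
qed

text \<open>Kronecker's density theorem, applied to the target rotated back by \<open>N\<close>
  steps so that the time found is at least \<open>N\<close>.\<close>

lemma rotation_orbit_dense:
  fixes \<alpha> :: real
  assumes "\<alpha> \<notin> \<rat>" "\<epsilon> > 0"
  obtains k n :: int where "k \<ge> N" "\<bar>x + of_int k * \<alpha> + of_int n - y\<bar> < \<epsilon>"
proof -
  obtain h k where "k > 0" and k: "\<bar>of_int k * \<alpha> - of_int h - (y - x - of_int N * \<alpha>)\<bar> < \<epsilon>"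
    using sequence_of_fractional_parts_is_dense[OF assms] by blast
  have "of_int k * \<alpha> - of_int h - (y - x - of_int N * \<alpha>) = x + of_int (k + N) * \<alpha> + of_int (- h) - y"
    by (simp add: algebra_simps)
  with k \<open>k > 0\<close> show thesis by (intro that[of "k + N" "- h"]) auto
qed

lemma div_set_dense:
  assumes "\<alpha> \<notin> \<rat>" "circle_fun \<phi>" "div_set sm sp \<alpha> \<phi> \<noteq> {}" "\<epsilon> > 0"
  obtains x where "x \<in> div_set sm sp \<alpha> \<phi>" "\<bar>x - y\<bar> < \<epsilon>"
proof -
  obtain x0 where x0: "x0 \<in> div_set sm sp \<alpha> \<phi>" using assms(3) by blast
  obtain k n :: int where "\<bar>x0 + of_int k * \<alpha> + of_int n - y\<bar> < \<epsilon>"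
    using rotation_orbit_dense[OF assms(1,4)] by blast
  with div_set_translate[OF assms(2) x0] show thesis by (rule that)
qed

section \<open>Transitivity from recurrence between open sets\<close>

lemma open_polar_neighbourhood:
  assumes "open U" "U \<noteq> {}"
  obtains r \<omega> \<delta> where "r > 0" "\<delta> > 0"
    "\<And>x. \<bar>x - \<omega>\<bar> < \<delta> \<Longrightarrow> complex_of_real r * cis (2 * pi * x) \<in> U"
proof -
  \<comment> \<open>A nonzero point is chosen so that its radius is positive; it exists because a
    singleton is not open in the plane.\<close>
  obtain z where z: "z \<in> U" "z \<noteq> 0"
    using assms by (metis all_not_in_conv insertI1 not_open_singleton subsetI subset_singletonD)
  obtain r \<omega> where r: "r \<ge> 0" and z_polar: "z = complex_of_real r * cis (2 * pi * \<omega>)"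
    by (rule polar_coordinates_exist)
  let ?g = "\<lambda>x. complex_of_real r * cis (2 * pi * x)"
  have "open (?g -` U)"
    by (rule open_vimage[OF assms(1)]) (intro continuous_intros)
  moreover have "\<omega> \<in> ?g -` U" using z z_polar by simp
  ultimately obtain \<delta> where "\<delta> > 0" and \<delta>: "\<And>x. dist x \<omega> < \<delta> \<Longrightarrow> x \<in> ?g -` U"
    unfolding open_dist by metis
  then show thesis
    using r z(2) z_polar by (intro that[of r \<delta> \<omega>]) (auto simp: dist_real_def)
qed

text \<open>Birkhoff's transitivity criterion: by Baire, some point visits every member of a
  countable basis, and its forward orbit is already dense.\<close>

lemma topologically_transitiveI:
  fixes f :: "'a::euclidean_space \<Rightarrow> 'a"
  assumes "continuous_on UNIV f"
    and recur: "\<And>U V. open U \<Longrightarrow> U \<noteq> {} \<Longrightarrow> open V \<Longrightarrow> V \<noteq> {} \<Longrightarrow> \<exists>n x. x \<in> U \<and> (f ^^ n) x \<in> V"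
  shows "topologically_transitive f"
proof -
  obtain \<B> :: "'a set set" where \<B>: "countable \<B>" "topological_basis \<B>"
    using ex_countable_basis by blast
  \<comment> \<open>\<open>O' V\<close> collects the points whose forward orbit meets
    \<open>V\<close>; it is open by continuity and dense by recurrence.\<close>
  define O' where "O' V = (\<Union>n. (f ^^ n) -` V)" for V
  have cont: "continuous_on UNIV (f ^^ n)" for n
  proof (induction n)
    case (Suc n)
    then have "continuous_on UNIV (\<lambda>x. f ((f ^^ n) x))"
      by (rule continuous_on_compose2[OF assms(1)]) simp
    then show ?case by (simp add: o_def)
  qed (simp add: id_def)
  have "UNIV \<subseteq> closure (\<Inter> (O' ` (\<B> - {{}})))"
  proof (rule Baire)
    fix T assume "T \<in> O' ` (\<B> - {{}})"
    then obtain V where V: "V \<in> \<B>" "V \<noteq> {}" and T: "T = O' V" by blast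
    have "open V" using V \<B>(2) by (simp add: topological_basis_open)
    then have "open T" unfolding T O'_def by (intro open_UN ballI open_vimage cont)
    moreover have "x \<in> closure T" for x
    proof (rule closure_iff_nhds_not_empty[THEN iffD2], intro allI impI)
      fix A U assume U: "U \<subseteq> A" "open U" "x \<in> U"
      then obtain n y where "y \<in> U" "(f ^^ n) y \<in> V" using recur[of U V] \<open>open V\<close> V by blast
      then show "T \<inter> A \<noteq> {}" using U unfolding T O'_def by blast
    qed
    ultimately show "openin (top_of_set UNIV) T \<and> UNIV \<subseteq> closure T" by auto
  qed (use \<B> in auto)
  then have "\<Inter> (O' ` (\<B> - {{}})) \<noteq> {}" by (metis closure_empty UNIV_not_empty subset_empty)
  then obtain p where p: "\<And>V. V \<in> \<B> \<Longrightarrow> V \<noteq> {} \<Longrightarrow> p \<in> O' V" by blast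
  have "x \<in> closure (two_sided_orbit f p)" for x
  proof (rule closure_iff_nhds_not_empty[THEN iffD2], intro allI impI)
    fix A U assume U: "U \<subseteq> A" "open U" "x \<in> U"
    then obtain V where V: "V \<in> \<B>" "x \<in> V" "V \<subseteq> U"
      using \<B>(2) topological_basisE by blast
    then obtain n where "(f ^^ n) p \<in> V" using p[of V] by (auto simp: O'_def)
    moreover have "(f ^^ n) p = int_iterate f (int n) p" by (simp add: int_iterate_def)
    ultimately show "two_sided_orbit f p \<inter> A \<noteq> {}"
      using U V unfolding two_sided_orbit_def by blast
  qed
  then show ?thesis unfolding topologically_transitive_def by blast
qed

text \<open>
  Points where the Birkhoff sums tend to \<open>+\<infinity>\<close> and to \<open>-\<infinity>\<close> are both dense, so over every arc
  the Birkhoff sums of a late return time take every prescribed value.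
\<close>
theorem topologically_transitive_skew_map:
  assumes \<alpha>: "\<alpha> \<notin> \<rat>" and \<phi>: "circle_fun \<phi>"
    and nonempty: "div_set s Plus \<alpha> \<phi> \<noteq> {}" "div_set t Minus \<alpha> \<phi> \<noteq> {}"
  shows "topologically_transitive (skew_map \<alpha> \<phi>)"
proof (rule topologically_transitiveI)
  show "continuous_on UNIV (skew_map \<alpha> \<phi>)" by (rule continuous_skew_map[OF \<phi>])
  fix U V :: "complex set"
  assume U: "open U" "U \<noteq> {}" and V: "open V" "V \<noteq> {}"
  obtain r1 \<omega>1 \<delta>1 where r1: "r1 > 0" and \<delta>1: "\<delta>1 > 0"
    "\<And>x. \<bar>x - \<omega>1\<bar> < \<delta>1 \<Longrightarrow> complex_of_real r1 * cis (2 * pi * x) \<in> U"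
    by (rule open_polar_neighbourhood[OF U]) blast
  obtain r2 \<omega>2 \<delta>2 where r2: "r2 > 0" and \<delta>2: "\<delta>2 > 0"
    "\<And>x. \<bar>x - \<omega>2\<bar> < \<delta>2 \<Longrightarrow> complex_of_real r2 * cis (2 * pi * x) \<in> V"
    by (rule open_polar_neighbourhood[OF V]) blast
  \<comment> \<open>The point lies within \<delta> of \<open>\<omega>1\<close> and the rotation adds
    an error of \<delta> at \<open>\<omega>2\<close>, so the image angle is off by less than
    \<open>2 * \<delta>\<close>.\<close>
  define \<delta> where "\<delta> = min \<delta>1 \<delta>2 / 2"
  have \<delta>: "\<delta> > 0" "\<delta> < \<delta>1" "2 * \<delta> \<le> \<delta>2" using \<delta>1(1) \<delta>2(1) by (auto simp: \<delta>_def)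
  obtain x1 where x1: "x1 \<in> div_set s Plus \<alpha> \<phi>" "\<bar>x1 - \<omega>1\<bar> < \<delta>"
    using div_set_dense[OF \<alpha> \<phi> nonempty(1) \<delta>(1)] by blast
  obtain x2 where x2: "x2 \<in> div_set t Minus \<alpha> \<phi>" "\<bar>x2 - \<omega>1\<bar> < \<delta>"
    using div_set_dense[OF \<alpha> \<phi> nonempty(2) \<delta>(1)] by blast
  \<comment> \<open>The Birkhoff sum that carries radius \<open>r1\<close> exactly to
    \<open>r2\<close>.\<close>
  define v where "v = ln (r2 / r1)"
  have "eventually (\<lambda>m. birkhoff_sum \<alpha> \<phi> m x1 \<ge> v) at_top"
       "eventually (\<lambda>m. birkhoff_sum \<alpha> \<phi> m x2 \<le> v) at_top"
    using x1(1) x2(1) by (auto simp: div_set_def filterlim_at_top filterlim_at_bot)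
  then have "eventually (\<lambda>m. birkhoff_sum \<alpha> \<phi> m x2 \<le> v \<and> v \<le> birkhoff_sum \<alpha> \<phi> m x1) at_top"
    by eventually_elim blast
  then obtain N where N: "\<And>m. m \<ge> N \<Longrightarrow> birkhoff_sum \<alpha> \<phi> m x2 \<le> v \<and> v \<le> birkhoff_sum \<alpha> \<phi> m x1"
    by (auto simp: eventually_at_top_linorder)
  obtain k n where k: "k \<ge> max 0 N" and kn: "\<bar>\<omega>1 + of_int k * \<alpha> + of_int n - \<omega>2\<bar> < \<delta>"
    using rotation_orbit_dense[OF \<alpha> \<delta>(1)] by blast
  have cont: "continuous_on S (birkhoff_sum \<alpha> \<phi> k)" for S
    by (rule continuous_on_subset[OF _ subset_UNIV])
       (use circle_fun_birkhoff_sum[OF \<phi>] in \<open>simp add: circle_fun_def\<close>)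
  obtain x where "x \<in> closed_segment x2 x1" and bx: "birkhoff_sum \<alpha> \<phi> k x = v"
    using IVT'_closed_segment_real[of v "birkhoff_sum \<alpha> \<phi> k" x2 x1] N[of k] k cont
    by (auto simp: closed_segment_eq_real_ivl)
  then have x: "\<bar>x - \<omega>1\<bar> < \<delta>"
    using x1 x2 by (auto simp: closed_segment_eq_real_ivl split: if_splits)
  let ?p = "complex_of_real r1 * cis (2 * pi * x)"
  have "(skew_map \<alpha> \<phi> ^^ nat k) ?p = int_iterate (skew_map \<alpha> \<phi>) k ?p"
    using k by (simp add: int_iterate_def)
  also have "\<dots> = complex_of_real (r1 * exp v) * cis (2 * pi * (x + of_int k * \<alpha>))"
    using int_iterate_skew_map[OF \<phi>, of r1 \<alpha> k x] r1 bx by simp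
  also have "r1 * exp v = r2" using r1 r2 by (simp add: v_def)
  also have "cis (2 * pi * (x + of_int k * \<alpha>)) = cis (2 * pi * (x + of_int k * \<alpha> + of_int n))"
    by (simp add: distrib_left flip: cis_mult)
  also have "complex_of_real r2 * \<dots> \<in> V"
    by (rule \<delta>2(2)) (use x kn \<delta>(3) in linarith)
  finally have "(skew_map \<alpha> \<phi> ^^ nat k) ?p \<in> V" .
  moreover have "?p \<in> U" using \<delta>1(2) x \<delta>(2) by force
  ultimately show "\<exists>n x. x \<in> U \<and> (skew_map \<alpha> \<phi> ^^ n) x \<in> V" by blast
qed

section \<open>Hausdorff dimension in polar coordinates\<close>

lemma sin_ge_half:
  fixes y :: real
  assumes "0 \<le> y" "y \<le> pi / 3"
  shows "sin y \<ge> y / 2"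
proof -
  have "sin 0 - 0 / 2 \<le> sin y - y / 2"
  proof (rule DERIV_nonneg_imp_nondecreasing[OF assms(1)])
    fix t assume t: "0 \<le> t" "t \<le> y"
    have "cos (pi / 3) \<le> cos t"
      by (rule cos_monotone_0_pi_le) (use t assms in auto)
    then have "cos t - 1 / 2 \<ge> 0" by (simp add: cos_60)
    moreover have "((\<lambda>t. sin t - t / 2) has_real_derivative cos t - 1 / 2) (at t)"
      by (auto intro!: derivative_eq_intros)
    ultimately show "\<exists>d. ((\<lambda>t. sin t - t / 2) has_real_derivative d) (at t) \<and> 0 \<le> d" by blast
  qed
  then show ?thesis by simp
qed

lemma polar_dist_radius:
  assumes "r \<ge> 0" "r' \<ge> 0"
  shows "\<bar>r - r'\<bar> \<le> dist (complex_of_real r * cis a) (complex_of_real r' * cis b)"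
  using norm_triangle_ineq3[of "complex_of_real r * cis a" "complex_of_real r' * cis b"] assms
  by (simp add: dist_norm norm_mult)

text \<open>Rotating both points by the angle of the second makes the second real; the imaginary
  part of the first, a radius of at least 1 times a sine, then bounds the distance from
  below.\<close>

lemma polar_dist_angle:
  assumes "r \<ge> 1" "\<bar>x - x'\<bar> \<le> 1 / 6"
  shows "\<bar>x - x'\<bar> \<le> dist (complex_of_real r * cis (2 * pi * x)) (complex_of_real r' * cis (2 * pi * x'))"
proof -
  let ?y = "2 * pi * (x - x')"
  have "\<bar>?y\<bar> / 2 \<le> sin \<bar>?y\<bar>"
    by (rule sin_ge_half) (use assms(2) in \<open>auto simp: abs_mult\<close>)
  also have "sin \<bar>?y\<bar> \<le> \<bar>sin ?y\<bar>" by (simp add: abs_if)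
  finally have "pi * \<bar>x - x'\<bar> \<le> \<bar>sin ?y\<bar>" by (simp add: abs_mult)
  moreover have "1 * \<bar>x - x'\<bar> \<le> pi * \<bar>x - x'\<bar>"
    using pi_gt3 by (intro mult_right_mono) auto
  ultimately have "\<bar>x - x'\<bar> \<le> \<bar>sin ?y\<bar>" by simp
  also have "\<dots> \<le> r * \<bar>sin ?y\<bar>"
    using assms(1) mult_right_mono[of 1 r "\<bar>sin ?y\<bar>"] by simp
  also have "\<dots> = \<bar>Im (complex_of_real r * cis ?y - complex_of_real r')\<bar>"
    using assms(1) by (simp add: abs_mult)
  also have "\<dots> \<le> norm (complex_of_real r * cis ?y - complex_of_real r')"
    by (rule abs_Im_le_cmod)
  also have "\<dots> = norm ((complex_of_real r * cis ?y - complex_of_real r') * cis (2 * pi * x'))"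
    by (simp add: norm_mult)
  also have "(complex_of_real r * cis ?y - complex_of_real r') * cis (2 * pi * x') =
      complex_of_real r * cis (2 * pi * x) - complex_of_real r' * cis (2 * pi * x')"
    by (simp add: left_diff_distrib mult.assoc cis_mult algebra_simps)
  finally show ?thesis by (simp add: dist_norm)
qed

lemma diam_powr_antimono:
  assumes "0 \<le> s" "s \<le> t" "t > 0" "diameter U \<le> 1" "bounded U"
  shows "diam_powr t U \<le> diam_powr s U"
  using assms diameter_ge_0[OF assms(5)]
  by (cases "diameter U = 0")
     (auto simp: diam_powr_def intro!: ennreal_leI powr_mono' simp flip: ennreal_1 intro: powr_le1)

text \<open>For diameters at most 1, lowering the exponent only increases the covering sums. A lower
  bound at exponent \<open>t\<close> and scale 1 thus keeps the measure positive for every exponent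
  up to \<open>t\<close>.\<close>

lemma hausdorff_dim_geI:
  assumes t: "t > 0" and c: "c > 0"
    and cover: "\<And>U :: nat \<Rightarrow> 'a::metric_space set.
      A \<subseteq> (\<Union>i. U i) \<Longrightarrow> (\<And>i. bounded (U i)) \<Longrightarrow> (\<And>i. diameter (U i) \<le> 1) \<Longrightarrow>
      c \<le> (\<Sum>i. diam_powr t (U i))"
  shows "hausdorff_dim A \<ge> ennreal t"
  unfolding hausdorff_dim_def
proof (intro INF_greatest ennreal_leI, rule ccontr)
  fix s assume "s \<in> {s. s \<ge> 0 \<and> hausdorff_measure s A = 0}" and "\<not> t \<le> s"
  then have s: "0 \<le> s" "s \<le> t" and zero: "hausdorff_measure s A = 0" by auto
  have "c \<le> hausdorff_premeasure s 1 A"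
    unfolding hausdorff_premeasure_def
  proof (rule INF_greatest)
    fix U :: "nat \<Rightarrow> 'a set"
    assume "U \<in> {U. A \<subseteq> (\<Union>i. U i) \<and> (\<forall>i. bounded (U i) \<and> diameter (U i) \<le> 1)}"
    then have U: "A \<subseteq> (\<Union>i. U i)" "\<And>i. bounded (U i)" "\<And>i. diameter (U i) \<le> 1" by auto
    have "c \<le> (\<Sum>i. diam_powr t (U i))" by (rule cover[OF U])
    also have "\<dots> \<le> (\<Sum>i. diam_powr s (U i))"
      by (intro suminf_le diam_powr_antimono s t U) auto
    finally show "c \<le> (\<Sum>i. diam_powr s (U i))" .
  qed
  also have "\<dots> \<le> hausdorff_measure s A"
    unfolding hausdorff_measure_def by (rule SUP_upper) simp
  finally show False using c zero by simp
qed

text \<open>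
  In polar coordinates a set of diameter \<open>d\<close> meets the range of \<open>G\<close> in a rectangle with sides of
  order \<open>d\<close> and \<open>\<surd>d\<close>, while the parameter square has area 1.
\<close>
lemma hausdorff_dim_polar_ge:
  fixes G :: "real \<Rightarrow> real"
  assumes K: "K > 0" and holder: "\<And>y y'. y \<in> {0..<1} \<Longrightarrow> y' \<in> {0..<1} \<Longrightarrow> (y - y')\<^sup>2 \<le> K * \<bar>G y - G y'\<bar>"
    and short: "\<And>y y'. y \<in> {0..<1} \<Longrightarrow> y' \<in> {0..<1} \<Longrightarrow> \<bar>G y - G y'\<bar> \<le> 1 / 6"
    and sub: "\<And>r y. r \<ge> 1 \<Longrightarrow> y \<in> {0..<1} \<Longrightarrow> complex_of_real r * cis (2 * pi * G y) \<in> A"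
  shows "hausdorff_dim A \<ge> ennreal (3 / 2)"
proof (rule hausdorff_dim_geI)
  \<comment> \<open>The area of the parameter rectangle of a set of diameter \<open>d\<close> is
    \<open>2 * d * (2 * sqrt (K * d))\<close>, that is \<open>C * d powr (3 / 2)\<close>.\<close>
  define C where "C = 4 * sqrt K"
  have C: "C > 0" using K by (simp add: C_def)
  show "ennreal (1 / C) > 0" using C by simp
  fix U :: "nat \<Rightarrow> complex set"
  assume A: "A \<subseteq> (\<Union>i. U i)" and bdd: "\<And>i. bounded (U i)"
  let ?F = "\<lambda>r y. complex_of_real r * cis (2 * pi * G y)"
  let ?M = "lborel \<Otimes>\<^sub>M lborel :: (real \<times> real) measure"
  \<comment> \<open>Each covering set is replaced by a measurable rectangle in the
    \<open>(r, y)\<close> plane containing its parameters, so no measurability of \<open>G\<close>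
    has to be known.\<close>
  have "\<exists>R \<in> sets ?M. (\<forall>r \<ge> 1. \<forall>y \<in> {0..<1}. ?F r y \<in> U i \<longrightarrow> (r, y) \<in> R) \<and>
      emeasure ?M R \<le> ennreal C * diam_powr (3 / 2) (U i)" for i
  proof (cases "\<exists>r \<ge> 1. \<exists>y \<in> {0..<1}. ?F r y \<in> U i")
    case False
    then show ?thesis by (intro bexI[of _ "{}"]) auto
  next
    case True
    then obtain r0 y0 where r0: "r0 \<ge> 1" and y0: "y0 \<in> {0..<1}" and U0: "?F r0 y0 \<in> U i" by blast
    define d where "d = diameter (U i)"
    have d: "d \<ge> 0" using diameter_ge_0[OF bdd] by (simp add: d_def)
    define R where "R = {r0 - d..r0 + d} \<times> {y0 - sqrt (K * d)..y0 + sqrt (K * d)}"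
    have "(r, y) \<in> R" if ry: "r \<ge> 1" "y \<in> {0..<1}" "?F r y \<in> U i" for r y
    proof -
      have dist: "dist (?F r y) (?F r0 y0) \<le> d"
        unfolding d_def by (rule diameter_bounded_bound[OF bdd ry(3) U0])
      have "\<bar>r - r0\<bar> \<le> d"
        using polar_dist_radius[of r r0] dist ry(1) r0 by (meson order_trans zero_le_one)
      moreover have "\<bar>G y - G y0\<bar> \<le> d"
        using polar_dist_angle[OF ry(1) short[OF ry(2) y0]] dist by (meson order_trans)
      then have "(y - y0)\<^sup>2 \<le> K * d"
        using holder[OF ry(2) y0] K by (meson mult_left_mono order_trans less_imp_le)
      then have "\<bar>y - y0\<bar> \<le> sqrt (K * d)"
        using real_le_rsqrt by (metis power2_abs)
      ultimately show ?thesis by (auto simp: R_def abs_le_iff)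
    qed
    moreover have "emeasure ?M R \<le> ennreal C * diam_powr (3 / 2) (U i)"
    proof -
      have "emeasure ?M R = ennreal (2 * d) * ennreal (2 * sqrt (K * d))"
        unfolding R_def using d K by (subst lborel.emeasure_pair_measure_Times) auto
      also have "\<dots> = ennreal (C * (d * sqrt d))"
        using d K by (subst ennreal_mult[symmetric]) (auto simp: C_def real_sqrt_mult algebra_simps)
      also have "d * sqrt d = d powr (3 / 2)"
      proof (cases "d = 0")
        case False
        then have "d powr (1 + 1 / 2) = d * sqrt d"
          using d by (subst powr_add) (simp add: powr_half_sqrt)
        then show ?thesis by simp
      qed simp
      finally show ?thesis
        using U0 C by (auto simp: diam_powr_def d_def ennreal_mult)
    qed
    moreover have "R \<in> sets ?M" unfolding R_def by auto
    ultimately show ?thesis by blast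
  qed
  then obtain R where R: "\<And>i. R i \<in> sets ?M"
    "\<And>i r y. r \<ge> 1 \<Longrightarrow> y \<in> {0..<1} \<Longrightarrow> ?F r y \<in> U i \<Longrightarrow> (r, y) \<in> R i"
    "\<And>i. emeasure ?M (R i) \<le> ennreal C * diam_powr (3 / 2) (U i)"
    by metis
  have "1 = emeasure ?M ({1..2} \<times> {0..<1})"
    by (subst lborel.emeasure_pair_measure_Times) auto
  also have "\<dots> \<le> emeasure ?M (\<Union>i. R i)"
  proof (rule emeasure_mono)
    show "{1..2} \<times> {0..<1} \<subseteq> (\<Union>i. R i)"
    proof clarify
      fix r y :: real assume ry: "r \<in> {1..2}" "y \<in> {0..<1}"
      then have "?F r y \<in> A" by (intro sub) auto
      then obtain i where "?F r y \<in> U i" using A by blast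
      then show "(r, y) \<in> (\<Union>i. R i)" using R(2)[of r y i] ry by auto
    qed
  qed (use R in auto)
  also have "\<dots> \<le> (\<Sum>i. emeasure ?M (R i))"
    by (rule emeasure_subadditive_countably) (use R in auto)
  also have "\<dots> \<le> (\<Sum>i. ennreal C * diam_powr (3 / 2) (U i))"
    by (intro suminf_le R) auto
  also have "\<dots> = ennreal C * (\<Sum>i. diam_powr (3 / 2) (U i))" by simp
  finally have "ennreal (1 / C) * 1 \<le> ennreal (1 / C) * (ennreal C * (\<Sum>i. diam_powr (3 / 2) (U i)))"
    by (rule mult_left_mono) simp
  then show "ennreal (1 / C) \<le> (\<Sum>i. diam_powr (3 / 2) (U i))"
    using C by (simp add: mult.assoc[symmetric] ennreal_mult[symmetric])
qed simp

section \<open>The rotation angle\<close>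

text \<open>Large enough that an amplitude growth of 128 per level still gives the ratio
  \<open>128 / base\<close> = 2^-13 from one level to the next.\<close>

definition base :: nat where "base = 2 ^ 20"

text \<open>The growing exponent leaves room for \<open>base ^ n\<close> digits at place
  \<open>n\<close>, and the offset 3 keeps all of them tiny relative to
  \<open>period n\<close>.\<close>

definition period :: "nat \<Rightarrow> nat" where "period j = base ^ (j + 3)"

definition denom :: "nat \<Rightarrow> nat" where "denom n = (\<Prod>j<n. period j)"

lemma base_pos [simp]: "base > 0" "real base > 0" "base \<noteq> 0"
  by (simp_all add: base_def)

lemma period_pos [simp]: "period j > 0" "real (period j) > 0" "period j \<noteq> 0"
  by (simp_all add: period_def)

lemma denom_pos [simp]: "denom j > 0" "real (denom j) > 0"
  by (simp_all add: denom_def prod_pos)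

lemma denom_0 [simp]: "denom 0 = 1"
  by (simp add: denom_def)

lemma denom_Suc [simp]: "denom (Suc n) = period n * denom n"
  by (simp add: denom_def mult.commute)

lemma period_ge_2: "period j \<ge> 2"
proof -
  have "base ^ 1 \<le> period j" unfolding period_def by (rule power_increasing) (auto simp: base_def)
  then show ?thesis by (simp add: base_def)
qed

lemma denom_ge: "2 ^ i * denom j \<le> denom (j + i)"
proof (induction i)
  case (Suc i)
  have "2 ^ Suc i * denom j = 2 * (2 ^ i * denom j)" by simp
  also have "\<dots> \<le> period (j + i) * denom (j + i)"
    by (rule mult_mono[OF period_ge_2 Suc]) auto
  finally show ?case by simp
qed simp

text \<open>
  For \<open>0 \<le> a n \<le> period n\<close>, \<open>radix_tail a 0\<close> is the number with digits \<open>a\<close> in the mixed-radix system with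
  bases \<open>period n\<close>, and \<open>radix_tail a j\<close> represents \<open>denom j * radix_tail a 0\<close> modulo 1.
\<close>
definition radix_tail :: "(nat \<Rightarrow> int) \<Rightarrow> nat \<Rightarrow> real" where
  "radix_tail a j = (\<Sum>i. real (denom j) * of_int (a (j + i)) / real (denom (Suc (j + i))))"

text \<open>The closed bound admits the digit \<open>period n\<close>: expansions need not be
  unique, and tails are bounded by 2 rather than by 1.\<close>

locale digits =
  fixes a :: "nat \<Rightarrow> int"
  assumes digit_nonneg: "0 \<le> a n" and digit_le: "a n \<le> int (period n)"
begin

lemma radix_tail_term_bounds:
  "0 \<le> real (denom j) * of_int (a (j + i)) / real (denom (Suc (j + i)))"
  "real (denom j) * of_int (a (j + i)) / real (denom (Suc (j + i))) \<le> (1 / 2) ^ i"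
proof -
  show "0 \<le> real (denom j) * of_int (a (j + i)) / real (denom (Suc (j + i)))"
    using digit_nonneg by simp
  have "real (2 ^ i * denom j) \<le> real (denom (j + i))"
    using denom_ge of_nat_le_iff by blast
  then have "2 ^ i * real (denom j) \<le> real (denom (j + i))" by simp
  moreover have "real_of_int (a (j + i)) \<le> real (period (j + i))"
    using digit_le[of "j + i"] by linarith
  ultimately have "2 ^ i * real (denom j) * of_int (a (j + i)) \<le> real (denom (j + i)) * real (period (j + i))"
    using digit_nonneg by (intro mult_mono) auto
  then show "real (denom j) * of_int (a (j + i)) / real (denom (Suc (j + i))) \<le> (1 / 2) ^ i"
    by (simp add: field_simps)
qed

lemma summable_radix_tail:
  "summable (\<lambda>i. real (denom j) * of_int (a (j + i)) / real (denom (Suc (j + i))))"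
proof (rule summable_comparison_test')
  show "summable (\<lambda>i. (1 / 2 :: real) ^ i)" by (rule summable_geometric) simp
  show "norm (real (denom j) * of_int (a (j + i)) / real (denom (Suc (j + i)))) \<le> (1 / 2) ^ i" for i
    using radix_tail_term_bounds[where j = j and i = i] by (simp only: real_norm_def abs_of_nonneg)
qed

lemma radix_tail_nonneg: "0 \<le> radix_tail a j"
  unfolding radix_tail_def by (intro suminf_nonneg summable_radix_tail radix_tail_term_bounds)

lemma radix_tail_le_2: "radix_tail a j \<le> 2"
proof -
  have "radix_tail a j \<le> (\<Sum>i. (1 / 2) ^ i)"
    unfolding radix_tail_def by (intro suminf_le summable_radix_tail radix_tail_term_bounds summable_geometric) simp
  also have "\<dots> = 2" by (simp add: suminf_geometric)
  finally show ?thesis .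
qed

text \<open>Multiplication by \<open>period j\<close> moves the radix point one place: it releases
  the digit \<open>a j\<close> and leaves the next tail.\<close>

lemma radix_tail_step: "radix_tail a j = (of_int (a j) + radix_tail a (Suc j)) / real (period j)"
proof -
  let ?t = "\<lambda>j i. real (denom j) * of_int (a (j + i)) / real (denom (Suc (j + i)))"
  have "radix_tail a j = ?t j 0 + (\<Sum>i. ?t j (Suc i))"
    unfolding radix_tail_def by (subst suminf_split_head[OF summable_radix_tail]) simp
  also have "(\<lambda>i. ?t j (Suc i)) = (\<lambda>i. ?t (Suc j) i / real (period j))"
    by (simp add: field_simps)
  also have "(\<Sum>i. ?t (Suc j) i / real (period j)) = radix_tail a (Suc j) / real (period j)"
    unfolding radix_tail_def by (rule suminf_divide[OF summable_radix_tail])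
  finally show ?thesis by (simp add: add_divide_distrib)
qed

end

text \<open>Horner's scheme for the integer formed by the first \<open>j\<close> digits.\<close>

primrec leading :: "(nat \<Rightarrow> int) \<Rightarrow> nat \<Rightarrow> int" where
  "leading a 0 = 0"
| "leading a (Suc j) = int (period j) * leading a j + a j"

lemma (in digits) denom_mult_radix_tail_0: "real (denom j) * radix_tail a 0 = of_int (leading a j) + radix_tail a j"
proof (induction j)
  case (Suc j)
  have "real (denom (Suc j)) * radix_tail a 0 = real (period j) * (real (denom j) * radix_tail a 0)" by simp
  also have "\<dots> = real (period j) * of_int (leading a j) + real (period j) * radix_tail a j"
    unfolding Suc by (simp add: distrib_left)
  also have "real (period j) * radix_tail a j = of_int (a j) + radix_tail a (Suc j)"
    by (subst radix_tail_step) simp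
  finally show ?case by simp
qed simp

definition angle :: real where "angle = radix_tail (\<lambda>_. 1) 0"

text \<open>This is \<eta> at level \<open>j\<close>, the excess of \<open>denom j * angle\<close>
  over an integer.\<close>

definition drift :: "nat \<Rightarrow> real" where "drift j = radix_tail (\<lambda>_. 1) j"

interpretation angle_digits: digits "\<lambda>_. 1"
proof
  show "1 \<le> int (period n)" for n
    using period_ge_2[of n] by linarith
qed simp

lemma drift_bounds: "1 / real (period j) \<le> drift j" "drift j \<le> 3 / real (period j)"
  using angle_digits.radix_tail_step[of j] angle_digits.radix_tail_nonneg[of "Suc j"] angle_digits.radix_tail_le_2[of "Suc j"]
  by (auto simp: drift_def divide_right_mono)

lemma denom_mult_angle: "real (denom j) * angle = of_int (leading (\<lambda>_. 1) j) + drift j"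
  unfolding angle_def drift_def by (rule angle_digits.denom_mult_radix_tail_0)

lemma less_period: "j < period j"
proof -
  have "j < 2 ^ j" by (rule less_exp)
  also have "\<dots> \<le> base ^ j" by (rule power_mono) (auto simp: base_def)
  also have "\<dots> \<le> period j" unfolding period_def by (rule power_increasing) (auto simp: base_def)
  finally show ?thesis .
qed

text \<open>With a rational angle of denominator \<open>d\<close>, every \<open>d * drift j\<close>
  would be an integer, yet for large \<open>j\<close> it lies strictly between 0 and 1.\<close>

lemma angle_irrational: "angle \<notin> \<rat>"
proof
  assume "angle \<in> \<rat>"
  then obtain c d :: int where d: "d > 0" and "angle = of_int c / of_int d"
    by (rule Rats_cases') auto
  then have cd: "of_int d * angle = of_int c" by (simp add: field_simps)
  \<comment> \<open>\<open>drift j\<close> is at most \<open>3 / period j\<close> and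
    \<open>period j\<close> exceeds \<open>j\<close>, so this \<open>j\<close> brings the product
    below 1.\<close>
  define j where "j = nat (3 * d)"
  have drift: "drift j = real (denom j) * angle - of_int (leading (\<lambda>_. 1) j)"
    using denom_mult_angle[of j] by simp
  have "of_int d * drift j = real (denom j) * (of_int d * angle) - of_int (d * leading (\<lambda>_. 1) j)"
    unfolding drift by (simp add: algebra_simps)
  also have "\<dots> = of_int (int (denom j) * c - d * leading (\<lambda>_. 1) j)"
    by (simp add: cd)
  finally obtain N :: int where int: "of_int d * drift j = of_int N" by blast
  have "drift j > 0" using drift_bounds(1)[of j] by (meson divide_pos_pos less_le_trans period_pos(2) zero_less_one)
  then have "of_int d * drift j > 0" using d by simp
  moreover have "of_int d * drift j < 1"
  proof -
    have "of_int d * drift j \<le> of_int d * (3 / real (period j))"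
      using d drift_bounds(2) by (intro mult_left_mono) auto
    also have "\<dots> < 1"
      using less_period[of j] d by (simp add: j_def)
    finally show ?thesis .
  qed
  ultimately show False unfolding int by simp
qed

section \<open>The wave\<close>

text \<open>The distance to the nearest integer.\<close>

definition tri :: "real \<Rightarrow> real" where
  "tri t = \<bar>t - of_int (round t)\<bar>"

lemma tri_le: "tri t \<le> \<bar>t - of_int n\<bar>"
  unfolding tri_def by (rule round_diff_minimal)

lemma tri_lipschitz: "\<bar>tri s - tri t\<bar> \<le> \<bar>s - t\<bar>"
  using tri_le[of s "round t"] tri_le[of t "round s"] by (simp add: tri_def)

lemma tri_eq:
  assumes "\<bar>t - of_int n\<bar> \<le> 1 / 2"
  shows "tri t = \<bar>t - of_int n\<bar>"
proof (rule antisym[OF tri_le])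
  show "\<bar>t - of_int n\<bar> \<le> tri t"
  proof (cases "round t = n")
    case False
    then have "\<bar>real_of_int (round t) - of_int n\<bar> \<ge> 1" by linarith
    then show ?thesis using assms unfolding tri_def by linarith
  qed (simp add: tri_def)
qed

lemma tri_periodic: "tri (t + of_int n) = tri t"
proof (rule antisym)
  show "tri (t + of_int n) \<le> tri t"
    using tri_le[of "t + of_int n" "round t + n"] by (simp add: tri_def)
  show "tri t \<le> tri (t + of_int n)"
    using tri_le[of t "round (t + of_int n) - n"] by (simp add: tri_def algebra_simps)
qed

text \<open>Level \<open>n\<close> takes charge at relative time 2^-25, when its gain must beat the
  loss \<open>width / 16\<close> = 2^-27 from lower levels; later the gain \<open>width / 2\<close>
  must beat the Lipschitz losses from level \<open>n + 2\<close> on.\<close>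

definition width :: real where "width = 1 / 2 ^ 23"

text \<open>Small enough that the offset loss of level \<open>n + 1\<close>, relatively
  \<open>256 * tol\<close> = 2^-32, is negligible, yet large enough to contain the spread
  \<open>3 / base ^ 3\<close> of the Cantor tails.\<close>

definition tol :: real where "tol = 1 / 2 ^ 40"

text \<open>
  A trapezoidal wave: it rises through 0 at phase 0 and falls through 0 at phase 1/2, both on an
  interval of length \<open>2 * width\<close>, and is otherwise constant \<open>\<plusminus>width\<close>, except for a peak at phase 1/4
  and a valley at phase 3/4.
\<close>
definition profile :: "real \<Rightarrow> real" where
  "profile t = max (- width) (min width (tri (t + 1 / 4) - 1 / 4))
     + max 0 (width - tri (t - 1 / 4)) - max 0 (width - tri (t + 1 / 4))"

lemma profile_periodic: "profile (t + of_int n) = profile t"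
  using tri_periodic[of "t + 1 / 4" n] tri_periodic[of "t - 1 / 4" n]
  by (simp add: profile_def algebra_simps)

lemma profile_lipschitz: "\<bar>profile s - profile t\<bar> \<le> 3 * \<bar>s - t\<bar>"
proof -
  define c where "c x = max (- width) (min width x)" for x
  define p where "p x = max 0 (width - x)" for x
  have "width > 0" by (simp add: width_def)
  then have c: "\<bar>c x - c y\<bar> \<le> \<bar>x - y\<bar>" for x y
    unfolding c_def by linarith
  have p: "\<bar>p x - p y\<bar> \<le> \<bar>x - y\<bar>" for x y
    unfolding p_def by linarith
  have "\<bar>c (tri (s + 1 / 4) - 1 / 4) - c (tri (t + 1 / 4) - 1 / 4)\<bar> \<le> \<bar>s - t\<bar>"
    "\<bar>p (tri (s - 1 / 4)) - p (tri (t - 1 / 4))\<bar> \<le> \<bar>s - t\<bar>"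
    "\<bar>p (tri (s + 1 / 4)) - p (tri (t + 1 / 4))\<bar> \<le> \<bar>s - t\<bar>"
    using c[of "tri (s + 1 / 4) - 1 / 4" "tri (t + 1 / 4) - 1 / 4"]
      p[of "tri (s - 1 / 4)" "tri (t - 1 / 4)"] p[of "tri (s + 1 / 4)" "tri (t + 1 / 4)"]
      tri_lipschitz[of "s + 1 / 4" "t + 1 / 4"] tri_lipschitz[of "s - 1 / 4" "t - 1 / 4"]
    by simp_all
  moreover have "\<bar>x + y - z - (x' + y' - z')\<bar> \<le> 3 * d"
    if "\<bar>x - x'\<bar> \<le> d" "\<bar>y - y'\<bar> \<le> d" "\<bar>z - z'\<bar> \<le> d" for x y z x' y' z' d :: real
    using that by linarith
  ultimately show ?thesis
    unfolding profile_def c_def[symmetric] p_def[symmetric] by blast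
qed

lemma profile_bound: "\<bar>profile t\<bar> \<le> 2 * width"
proof -
  define c where "c x = max (- width) (min width x)" for x
  define p where "p x = max 0 (width - x)" for x
  have "width > 0" by (simp add: width_def)
  then have "\<bar>c x\<bar> \<le> width" for x
    unfolding c_def by linarith
  moreover have "0 \<le> p (tri x)" "p (tri x) \<le> width" for x
    using \<open>width > 0\<close> unfolding p_def tri_def by linarith+
  ultimately have "\<bar>c (tri (t + 1 / 4) - 1 / 4)\<bar> \<le> width"
    "0 \<le> p (tri (t - 1 / 4))" "p (tri (t - 1 / 4)) \<le> width"
    "0 \<le> p (tri (t + 1 / 4))" "p (tri (t + 1 / 4)) \<le> width" by blast+
  then show ?thesis
    unfolding profile_def c_def[symmetric] p_def[symmetric] by linarith
qed

text \<open>Within 3/16 of one of the four phases the others are at least 1/16 away, which is more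
  than \<open>width\<close>, so only the local feature varies.\<close>

lemma profile_local:
  assumes "\<bar>u\<bar> \<le> 3 / 16"
  shows "profile u = max (- width) (min width u)"
    and "profile (1 / 4 + u) = width + max 0 (width - \<bar>u\<bar>)"
    and "profile (1 / 2 + u) = - max (- width) (min width u)"
    and "profile (3 / 4 + u) = - width - max 0 (width - \<bar>u\<bar>)"
proof -
  have w: "width \<le> 1 / 32" "width > 0" by (simp_all add: width_def)
  have u: "- (3 / 16) \<le> u" "u \<le> 3 / 16" using assms by auto
  have t: "tri (u + 1 / 4) = u + 1 / 4" "tri (u - 1 / 4) = 1 / 4 - u"
    "tri (1 / 4 + u + 1 / 4) = 1 / 2 - \<bar>u\<bar>" "tri (1 / 4 + u - 1 / 4) = \<bar>u\<bar>"
    "tri (1 / 2 + u + 1 / 4) = 1 / 4 - u" "tri (1 / 2 + u - 1 / 4) = 1 / 4 + u"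
    "tri (3 / 4 + u + 1 / 4) = \<bar>u\<bar>" "tri (3 / 4 + u - 1 / 4) = 1 / 2 - \<bar>u\<bar>"
    subgoal using tri_eq[of "u + 1 / 4" 0] u by simp
    subgoal using tri_eq[of "u - 1 / 4" 0] u by simp
    subgoal using tri_eq[of "u + 1 / 2" 0] tri_eq[of "u + 1 / 2" 1] u by (cases "u \<le> 0") (simp_all add: algebra_simps)
    subgoal using tri_eq[of u 0] u by simp
    subgoal using tri_eq[of "1 / 2 + u + 1 / 4" 1] u by simp
    subgoal using tri_eq[of "1 / 2 + u - 1 / 4" 0] u by simp
    subgoal using tri_eq[of "3 / 4 + u + 1 / 4" 1] u by simp
    subgoal using tri_eq[of "u + 1 / 2" 0] tri_eq[of "u + 1 / 2" 1] u by (cases "u \<le> 0") (simp_all add: algebra_simps)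
    done
  show "profile u = max (- width) (min width u)"
    unfolding profile_def t using w u by auto
  show "profile (1 / 4 + u) = width + max 0 (width - \<bar>u\<bar>)"
    unfolding profile_def t using w u by auto
  show "profile (1 / 2 + u) = - max (- width) (min width u)"
    unfolding profile_def t using w u by auto
  show "profile (3 / 4 + u) = - width - max 0 (width - \<bar>u\<bar>)"
    unfolding profile_def t using w u by auto
qed

primrec sign_val :: "sign \<Rightarrow> real" where
  "sign_val Minus = - 1"
| "sign_val Plus = 1"

text \<open>The phases, in quarters, of rising ramp, peak, falling ramp and valley. The first sign
  is that of the change to the left, the second that of the change to the right.\<close>

fun quarter :: "sign \<Rightarrow> sign \<Rightarrow> nat" where
  "quarter Minus Plus = 0"
| "quarter Minus Minus = 1"
| "quarter Plus Minus = 2"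
| "quarter Plus Plus = 3"

text \<open>Moving away from the phase, the wave changes with slope 1 until it flattens at about
  distance \<open>width\<close>. The offset \<open>u\<close> is paid for by \<open>2 * tol\<close>,
  at peak and valley on both sides of the tip.\<close>

lemma profile_gain:
  fixes u t :: real and sm sp :: sign
  assumes u: "\<bar>u\<bar> \<le> tol" and t: "0 \<le> t" "t \<le> 1 / 8"
  defines "z \<equiv> real (quarter sm sp) / 4"
  shows "min t (width / 2) - 2 * tol \<le> sign_val sp * (profile (z + u + t) - profile (z + u))"
    and "min t (width / 2) - 2 * tol \<le> sign_val sm * (profile (z + u - t) - profile (z + u))"
proof -
  have w: "tol \<le> width / 2" "tol > 0" "width \<le> 1 / 32" "width > 0" by (simp_all add: width_def tol_def)
  have local: "\<bar>u\<bar> \<le> 3 / 16" "\<bar>u + t\<bar> \<le> 3 / 16" "\<bar>u - t\<bar> \<le> 3 / 16"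
    using u t w by linarith+
  define c where "c x = max (- width) (min width x)" for x
  define p where "p x = max 0 (width - \<bar>x\<bar>)" for x
  have vals: "profile x = c x" "profile (1 / 4 + x) = width + p x"
    "profile (1 / 2 + x) = - c x" "profile (3 / 4 + x) = - width - p x"
    if "\<bar>x\<bar> \<le> 3 / 16" for x
    using profile_local[OF that] by (simp_all add: c_def p_def)
  have ramp: "min t (width / 2) - 2 * tol \<le> c (u + t) - c u"
    "min t (width / 2) - 2 * tol \<le> c u - c (u - t)"
    using u t w unfolding c_def by linarith+
  have peak: "min t (width / 2) - 2 * tol \<le> p u - p (u + t)"
    "min t (width / 2) - 2 * tol \<le> p u - p (u - t)"
    using u t w unfolding p_def by linarith+
  have assoc: "z + u + t = z + (u + t)" "z + u - t = z + (u - t)" by simp_all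
  have goal: "min t (width / 2) - 2 * tol \<le> sign_val sp * (profile (z + (u + t)) - profile (z + u)) \<and>
    min t (width / 2) - 2 * tol \<le> sign_val sm * (profile (z + (u - t)) - profile (z + u))"
  proof (cases sm; cases sp)
    assume s: "sm = Minus" "sp = Plus"
    then have z: "z = 0" by (simp add: z_def)
    show ?thesis unfolding s z add_0 local[THEN vals(1)]
      using ramp by (simp add: algebra_simps)
  next
    assume s: "sm = Minus" "sp = Minus"
    then have z: "z = 1 / 4" by (simp add: z_def)
    show ?thesis unfolding s z local[THEN vals(2)]
      using peak by (simp add: algebra_simps)
  next
    assume s: "sm = Plus" "sp = Minus"
    then have z: "z = 1 / 2" by (simp add: z_def)
    show ?thesis unfolding s z local[THEN vals(3)]
      using ramp by (simp add: algebra_simps)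
  next
    assume s: "sm = Plus" "sp = Plus"
    then have z: "z = 3 / 4" by (simp add: z_def)
    show ?thesis unfolding s z local[THEN vals(4)]
      using peak by (simp add: algebra_simps)
  qed
  show "min t (width / 2) - 2 * tol \<le> sign_val sp * (profile (z + u + t) - profile (z + u))"
    unfolding assoc using goal by (rule conjunct1)
  show "min t (width / 2) - 2 * tol \<le> sign_val sm * (profile (z + u - t) - profile (z + u))"
    unfolding assoc using goal by (rule conjunct2)
qed

section \<open>The cocycle\<close>

text \<open>Fast growth makes each amplitude dominate the sum of all earlier ones, while growth
  slower than that of \<open>period\<close> keeps the series of the cocycle convergent.\<close>

definition amp :: "nat \<Rightarrow> real" where "amp j = 128 ^ j"

lemma amp_pos [simp]: "amp j > 0"
  by (simp add: amp_def)

lemma sum_amp_le: "(\<Sum>j<n. amp j) \<le> amp n / 64"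
proof (induction n)
  case (Suc n)
  moreover have "amp (Suc n) = 128 * amp n" by (simp add: amp_def)
  ultimately show ?case using amp_pos[of n] unfolding sum.lessThan_Suc by linarith
qed (simp add: amp_def)

lemma amp_div_period: "amp (n + i) / real (period (n + i)) = amp n / real (period n) * (1 / 2 ^ 13) ^ i"
proof -
  have "(128 :: real) ^ i / real base ^ i = (1 / 2 ^ 13) ^ i"
    by (simp add: base_def flip: power_divide)
  moreover have "real (period (n + i)) = real (period n) * real base ^ i"
    by (simp add: period_def power_add)
  moreover have "amp (n + i) = amp n * 128 ^ i"
    by (simp add: amp_def power_add)
  ultimately show ?thesis
    by (metis times_divide_times_eq)
qed

lemma summable_amp_div_period: "summable (\<lambda>j. amp j / real (period j))"
proof -
  have "summable (\<lambda>i. amp 0 / real (period 0) * (1 / 2 ^ 13) ^ i)"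
    by (intro summable_mult summable_geometric) simp
  then show ?thesis using amp_div_period[of 0] by simp
qed

text \<open>
  At a time \<open>m\<close> just below \<open>period n\<close> level \<open>n\<close> dominates: lower levels have smaller amplitude,
  level \<open>n + 1\<close> has either not moved away from its good phase or is bounded by the Lipschitz
  estimate, and the higher levels are bounded by the Lipschitz estimate.
\<close>
lemma dominant_level:
  fixes D :: "nat \<Rightarrow> real" and m :: real
  assumes m: "real (period n) / (32 * real base) < m" "m \<le> real (period n) / 32"
    and gain: "\<And>j. m \<le> real (period j) / 32 \<Longrightarrow> min (m / real (period j)) (width / 2) - 2 * tol \<le> D j"
    and bound: "\<And>j. - 4 * width \<le> D j"
    and lipschitz: "\<And>j. - 9 * (m / real (period j)) \<le> D j"
    and summable: "summable (\<lambda>j. amp j * D j)"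
  shows "amp n / 2 ^ 27 \<le> (\<Sum>j. amp j * D j)"
proof -
  define x where "x = m / real (period n)"
  \<comment> \<open>The lower end is \<open>1 / (32 * base)\<close>.\<close>
  have x: "1 / 2 ^ 25 < x" "x \<le> 1 / 32"
    using m by (simp_all add: x_def field_simps base_def)
  define r :: real where "r = 1 / 2 ^ 13"
  have level: "- 9 * (amp n * x * r ^ i) \<le> amp (n + i) * D (n + i)" for i
  proof -
    have "- 9 * (amp n * x * r ^ i) = - 9 * (m * (amp n / real (period n) * r ^ i))"
      by (simp add: x_def)
    also have "\<dots> = - 9 * (m * (amp (n + i) / real (period (n + i))))"
      by (simp add: amp_div_period r_def)
    also have "\<dots> = amp (n + i) * (- 9 * (m / real (period (n + i))))" by simp
    also have "\<dots> \<le> amp (n + i) * D (n + i)"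
      by (intro mult_left_mono lipschitz less_imp_le amp_pos)
    finally show ?thesis .
  qed
  have low: "- (amp n * (width / 16)) \<le> (\<Sum>j<n. amp j * D j)"
  proof -
    have "- (amp n * (width / 16)) = - (4 * width) * (amp n / 64)" by simp
    also have "\<dots> \<le> - (4 * width) * (\<Sum>j<n. amp j)"
      by (intro mult_left_mono_neg sum_amp_le) (simp add: width_def)
    also have "\<dots> = (\<Sum>j<n. amp j * (- 4 * width))"
      unfolding sum_distrib_left by (intro sum.cong) auto
    also have "\<dots> \<le> (\<Sum>j<n. amp j * D j)"
      by (intro sum_mono mult_left_mono bound less_imp_le amp_pos)
    finally show ?thesis .
  qed
  have main: "amp n * (min x (width / 2) - 2 * tol) \<le> amp n * D n"
    using gain[OF m(2)] by (intro mult_left_mono) (auto simp: x_def less_imp_le)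
  \<comment> \<open>Level \<open>n + 1\<close> receives two bounds: a Lipschitz one, and one from
    the gain hypothesis, which leaves only the offset loss \<open>2 * tol\<close> times an amplitude
    128 times larger.\<close>
  have next1: "- (amp n * (9 * r * x)) \<le> amp (Suc n) * D (Suc n)"
    using level[of 1] by (simp add: ac_simps)
  have next2: "- (amp n * (256 * tol)) \<le> amp (Suc n) * D (Suc n)"
  proof -
    have "0 \<le> real (period n) / (32 * real base)" by simp
    then have pos: "m \<ge> 0" using m(1) by linarith
    have "real (period n) \<le> real (period (Suc n))"
      unfolding period_def of_nat_le_iff by (rule power_increasing) (auto simp: base_def)
    then have "m \<le> real (period (Suc n)) / 32" using m(2) by simp
    then have "min (m / real (period (Suc n))) (width / 2) - 2 * tol \<le> D (Suc n)" by (rule gain)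
    moreover have "0 \<le> min (m / real (period (Suc n))) (width / 2)"
      using pos by (simp add: width_def)
    ultimately have "- 2 * tol \<le> D (Suc n)" by linarith
    then have "amp (Suc n) * (- 2 * tol) \<le> amp (Suc n) * D (Suc n)"
      by (rule mult_left_mono[OF _ less_imp_le[OF amp_pos]])
    moreover have "amp (Suc n) * (- 2 * tol) = - (amp n * (256 * tol))"
      by (simp add: amp_def)
    ultimately show ?thesis by (simp only:)
  qed
  \<comment> \<open>The Lipschitz losses form a geometric series of ratio \<open>r\<close>; 18 is 9
    times the bound 2 for its sum factor.\<close>
  have high: "- (amp n * (18 * r\<^sup>2 * x)) \<le> (\<Sum>i. amp (i + (n + 2)) * D (i + (n + 2)))"
  proof -
    have r: "0 \<le> r" "r \<le> 1 / 2" by (simp_all add: r_def)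
    have geo: "(\<lambda>i. - 9 * (amp n * x * r\<^sup>2) * r ^ i) sums (- 9 * (amp n * x * r\<^sup>2) * (1 / (1 - r)))"
      using r by (intro sums_mult geometric_sums) auto
    have "1 / (1 - r) \<le> 2" using r by (simp add: field_simps)
    then have "- 9 * (amp n * x * r\<^sup>2) * 2 \<le> - 9 * (amp n * x * r\<^sup>2) * (1 / (1 - r))"
      using x by (intro mult_left_mono_neg) (auto simp: less_imp_le)
    also have "\<dots> = (\<Sum>i. - 9 * (amp n * x * r\<^sup>2) * r ^ i)"
      using sums_unique[OF geo] by simp
    also have "\<dots> \<le> (\<Sum>i. amp (i + (n + 2)) * D (i + (n + 2)))"
    proof (rule suminf_le)
      show "- 9 * (amp n * x * r\<^sup>2) * r ^ i \<le> amp (i + (n + 2)) * D (i + (n + 2))" for i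
        using level[of "i + 2"] by (simp add: power_add power2_eq_square ac_simps)
      show "summable (\<lambda>i. amp (i + (n + 2)) * D (i + (n + 2)))"
        using summable_ignore_initial_segment[OF summable] .
    qed (use geo in \<open>rule sums_summable\<close>)
    finally show ?thesis by (simp add: ac_simps)
  qed
  have split: "(\<Sum>j. amp j * D j) = (\<Sum>i. amp (i + (n + 2)) * D (i + (n + 2)))
      + ((\<Sum>j<n. amp j * D j) + amp n * D n + amp (Suc n) * D (Suc n))"
    using suminf_split_initial_segment[OF summable, of "n + 2"] by simp
  \<comment> \<open>For \<open>x\<close> near 1/32 the Lipschitz loss of level \<open>n + 1\<close>
    would exceed the gain \<open>width / 2\<close>, so the bound from the gain is taken
    there.\<close>
  define rest where "rest = (if x \<le> width / 2 then 9 * r * x else 256 * tol)"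
  have next_level: "- (amp n * rest) \<le> amp (Suc n) * D (Suc n)"
    using next1 next2 by (simp add: rest_def)
  have "1 / 2 ^ 27 \<le> min x (width / 2) - 2 * tol - width / 16 - rest - 18 * r\<^sup>2 * x"
  proof (cases "x \<le> width / 2")
    case True
    then show ?thesis using x by (simp add: rest_def width_def tol_def r_def power2_eq_square)
  next
    case False
    then show ?thesis using x by (simp add: rest_def width_def tol_def r_def power2_eq_square)
  qed
  then have "amp n * (1 / 2 ^ 27) \<le> amp n * (min x (width / 2) - 2 * tol - width / 16 - rest - 18 * r\<^sup>2 * x)"
    by (rule mult_left_mono[OF _ less_imp_le[OF amp_pos]])
  also have "\<dots> = amp n * (min x (width / 2) - 2 * tol) - amp n * (width / 16) - amp n * rest - amp n * (18 * r\<^sup>2 * x)"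
    by (simp add: right_diff_distrib)
  also have "\<dots> \<le> (\<Sum>j. amp j * D j)"
    using add_mono[OF high add_mono[OF add_mono[OF low main] next_level]]
    unfolding split by (simp only: algebra_simps)
  finally show ?thesis by simp
qed

text \<open>Each large time belongs to the window of some level \<open>n\<close>, which tends to
  infinity with the time; the dominant level then forces a value of at least
  \<open>amp n / 2 ^ 27\<close>.\<close>

lemma tendsto_at_top_of_levels:
  fixes D :: "nat \<Rightarrow> nat \<Rightarrow> real"
  assumes gain: "\<And>m j. real m \<le> real (period j) / 32 \<Longrightarrow>
      min (real m / real (period j)) (width / 2) - 2 * tol \<le> D m j"
    and bound: "\<And>m j. - 4 * width \<le> D m j"
    and lipschitz: "\<And>m j. - 9 * (real m / real (period j)) \<le> D m j"
    and summable: "\<And>m. summable (\<lambda>j. amp j * D m j)"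
  shows "filterlim (\<lambda>m. \<Sum>j. amp j * D m j) at_top at_top"
  unfolding filterlim_at_top
proof
  fix Z :: real
  obtain N where N: "Z * 2 ^ 27 < 128 ^ N"
    using real_arch_pow[of 128 "Z * 2 ^ 27"] by auto
  show "eventually (\<lambda>m. Z \<le> (\<Sum>j. amp j * D m j)) at_top"
  proof (rule eventually_at_top_linorderI)
    fix m assume m: "period N \<le> m"
    define n where "n = (LEAST n. real m \<le> real (period n) / 32)"
    have "real m \<le> real (period (32 * m)) / 32"
      using less_period[of "32 * m"] by simp
    then have n: "real m \<le> real (period n) / 32"
      unfolding n_def by (rule LeastI)
    have "n > N"
    proof (rule ccontr)
      assume "\<not> n > N"
      then have "period n \<le> period N"
        unfolding period_def by (intro power_increasing) (auto simp: base_def)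
      then show False using n m period_pos(1)[of n] by linarith
    qed
    then obtain k where k: "n = Suc k" using less_imp_Suc_add by blast
    \<comment> \<open>Minimality of \<open>n\<close> bounds \<open>m\<close> from below by the
      previous period, and one period is \<open>base\<close> times the previous one.\<close>
    have "\<not> real m \<le> real (period k) / 32"
      using not_less_Least[of k "\<lambda>n. real m \<le> real (period n) / 32"] k by (simp add: n_def)
    moreover have "real (period n) = real base * real (period k)"
      unfolding k period_def by (simp only: add_Suc power_Suc of_nat_mult)
    ultimately have "real (period n) / (32 * real base) < real m"
      by simp
    then have "amp n / 2 ^ 27 \<le> (\<Sum>j. amp j * D m j)"
      using n gain bound lipschitz summable by (intro dominant_level)
    moreover have "(128 :: real) ^ N \<le> amp n"
      unfolding amp_def by (rule power_increasing) (use \<open>n > N\<close> in auto)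
    ultimately show "Z \<le> (\<Sum>j. amp j * D m j)" using N by simp
  qed
qed

section \<open>The function \<phi> and its Birkhoff sums\<close>

definition increment :: "real \<Rightarrow> real \<Rightarrow> nat \<Rightarrow> real" where
  "increment m x j = profile (real (denom j) * x + m * drift j) - profile (real (denom j) * x)"

definition cocycle :: "real \<Rightarrow> real" where
  "cocycle x = (\<Sum>j. amp j * increment 1 x j)"

text \<open>The 9 is the Lipschitz constant 3 of \<open>profile\<close> times the 3 in the upper
  bound for \<open>drift\<close>.\<close>

lemma abs_increment_le: "\<bar>increment m x j\<bar> \<le> 9 * \<bar>m\<bar> / real (period j)"
proof -
  have "\<bar>increment m x j\<bar> \<le> 3 * \<bar>m * drift j\<bar>"
    using profile_lipschitz[of "real (denom j) * x + m * drift j" "real (denom j) * x"]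
    by (simp add: increment_def)
  also have "drift j \<ge> 0"
    using drift_bounds(1)[of j] by (meson divide_nonneg_nonneg of_nat_0_le_iff order_trans zero_le_one)
  then have "3 * \<bar>m * drift j\<bar> = 3 * \<bar>m\<bar> * drift j" by (simp add: abs_mult)
  also have "\<dots> \<le> 3 * \<bar>m\<bar> * (3 / real (period j))"
    by (intro mult_left_mono drift_bounds) auto
  finally show ?thesis by simp
qed

lemma abs_amp_increment_le: "\<bar>amp j * increment m x j\<bar> \<le> 9 * \<bar>m\<bar> * (amp j / real (period j))"
proof -
  have "\<bar>amp j * increment m x j\<bar> = amp j * \<bar>increment m x j\<bar>"
    by (simp add: abs_mult less_imp_le)
  also have "\<dots> \<le> amp j * (9 * \<bar>m\<bar> / real (period j))"
    by (intro mult_left_mono abs_increment_le less_imp_le amp_pos)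
  finally show ?thesis by (simp add: ac_simps)
qed

lemma summable_increment: "summable (\<lambda>j. amp j * increment m x j)"
  by (rule summable_comparison_test'[where N = 0 and g = "\<lambda>j. 9 * \<bar>m\<bar> * (amp j / real (period j))"])
     (use abs_amp_increment_le summable_mult[OF summable_amp_div_period] in \<open>simp_all only: real_norm_def\<close>)

lemma circle_fun_cocycle: "circle_fun cocycle"
proof -
  have cont: "continuous_on UNIV profile"
    by (rule lipschitz_on_continuous_on[of 3]) (auto simp: lipschitz_on_def dist_real_def profile_lipschitz)
  have inc: "continuous_on UNIV (\<lambda>x. increment 1 x j)" for j
    unfolding increment_def
    by (intro continuous_on_diff continuous_on_compose2[OF cont] continuous_intros) auto
  have "uniform_limit UNIV (\<lambda>n x. \<Sum>j<n. amp j * increment 1 x j) cocycle sequentially"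
    unfolding cocycle_def[abs_def]
    by (rule Weierstrass_m_test[where M = "\<lambda>j. 9 * \<bar>1\<bar> * (amp j / real (period j))"])
       (use abs_amp_increment_le summable_mult[OF summable_amp_div_period] in \<open>simp_all only: real_norm_def\<close>)
  then have "continuous_on UNIV cocycle"
    by (rule uniform_limit_theorem[rotated]) (auto intro!: always_eventually continuous_intros inc)
  moreover have "cocycle (x + 1) = cocycle x" for x
  proof -
    have "increment 1 (x + 1) j = increment 1 x j" for j
      using profile_periodic[of "real (denom j) * x" "int (denom j)"]
        profile_periodic[of "real (denom j) * x + drift j" "int (denom j)"]
      by (simp add: increment_def algebra_simps)
    then show ?thesis by (simp add: cocycle_def)
  qed
  ultimately show ?thesis by (simp add: circle_fun_def)
qed

text \<open>At level \<open>j\<close> one rotation advances the phase by \<open>drift j\<close>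
  modulo 1, so the one-step differences telescope.\<close>

lemma birkhoff_sum_cocycle_eq:
  "birkhoff_sum angle cocycle m x = (\<Sum>j. amp j * increment (of_int m) x j)"
proof (rule birkhoff_sum_unique)
  show "(\<Sum>j. amp j * increment (of_int 0) x j) = 0" by (simp add: increment_def)
  fix m :: int
  have "increment 1 (x + of_int m * angle) j = increment (of_int (m + 1)) x j - increment (of_int m) x j" for j
  proof -
    let ?y = "real (denom j) * x"
    have "real (denom j) * (x + of_int m * angle) = ?y + of_int m * (real (denom j) * angle)"
      by (simp add: algebra_simps)
    also have "\<dots> = ?y + of_int m * drift j + of_int (m * leading (\<lambda>_. 1) j)"
      unfolding denom_mult_angle by (simp add: algebra_simps)
    finally have y: "real (denom j) * (x + of_int m * angle) =
      ?y + of_int m * drift j + of_int (m * leading (\<lambda>_. 1) j)" .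
    have "profile (real (denom j) * (x + of_int m * angle)) = profile (?y + of_int m * drift j)"
      unfolding y by (rule profile_periodic)
    moreover have "profile (real (denom j) * (x + of_int m * angle) + 1 * drift j) =
        profile (?y + of_int (m + 1) * drift j)"
      unfolding y using profile_periodic[of "?y + of_int (m + 1) * drift j" "m * leading (\<lambda>_. 1) j"]
      by (simp add: algebra_simps)
    ultimately show ?thesis unfolding increment_def by simp
  qed
  then have "cocycle (x + of_int m * angle) =
      (\<Sum>j. amp j * increment (of_int (m + 1)) x j - amp j * increment (of_int m) x j)"
    by (simp add: cocycle_def right_diff_distrib)
  also have "\<dots> = (\<Sum>j. amp j * increment (of_int (m + 1)) x j) - (\<Sum>j. amp j * increment (of_int m) x j)"
    by (intro suminf_diff[symmetric] summable_increment)
  finally show "(\<Sum>j. amp j * increment (of_int (m + 1)) x j) =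
      (\<Sum>j. amp j * increment (of_int m) x j) + cocycle (x + of_int m * angle)" by simp
qed

section \<open>Points of prescribed divergence\<close>

definition good :: "sign \<Rightarrow> sign \<Rightarrow> real \<Rightarrow> bool" where
  "good sm sp x \<longleftrightarrow> (\<forall>j. \<exists>(n::int) u. \<bar>u\<bar> \<le> tol \<and>
     real (denom j) * x = real (quarter sm sp) / 4 + u + of_int n)"

lemma increment_bound: "\<bar>increment m x j\<bar> \<le> 4 * width"
  using profile_bound[of "real (denom j) * x + m * drift j"] profile_bound[of "real (denom j) * x"]
  unfolding increment_def by linarith

text \<open>By the drift bounds, the phase has moved at least \<open>m / period j\<close> and at
  most 3/32, hence it is still in the range 1/8 where the local shape decides.\<close>

lemma good_increment:
  assumes "good sm sp x" and m: "real m \<le> real (period j) / 32"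
  shows "min (real m / real (period j)) (width / 2) - 2 * tol \<le> sign_val sp * increment (real m) x j"
    and "min (real m / real (period j)) (width / 2) - 2 * tol \<le> sign_val sm * increment (- real m) x j"
proof -
  obtain n :: int and u where u: "\<bar>u\<bar> \<le> tol"
    and x: "real (denom j) * x = real (quarter sm sp) / 4 + u + of_int n"
    using assms(1) unfolding good_def by blast
  define t where "t = real m * drift j"
  have t1: "real m / real (period j) \<le> t"
    unfolding t_def using mult_left_mono[OF drift_bounds(1)[of j], of "real m"] by simp
  have t0: "0 \<le> t" using t1 by (meson divide_nonneg_nonneg of_nat_0_le_iff order_trans)
  have "t \<le> real m * (3 / real (period j))"
    unfolding t_def by (intro mult_left_mono drift_bounds) simp
  also have "\<dots> \<le> 1 / 8" using m by (simp add: field_simps)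
  finally have t2: "t \<le> 1 / 8" .
  have "increment s x j = profile (real (quarter sm sp) / 4 + u + s * drift j) - profile (real (quarter sm sp) / 4 + u)" for s
    using profile_periodic[of "real (quarter sm sp) / 4 + u + s * drift j" n]
      profile_periodic[of "real (quarter sm sp) / 4 + u" n]
    unfolding increment_def x by (simp add: add_ac)
  from this[of "real m"] this[of "- real m"]
  have inc: "increment (real m) x j = profile (real (quarter sm sp) / 4 + u + t) - profile (real (quarter sm sp) / 4 + u)"
    "increment (- real m) x j = profile (real (quarter sm sp) / 4 + u - t) - profile (real (quarter sm sp) / 4 + u)"
    by (simp_all add: t_def)
  have "min (real m / real (period j)) (width / 2) - 2 * tol \<le> min t (width / 2) - 2 * tol"
    using t1 by (intro diff_right_mono min.mono) auto
  then show "min (real m / real (period j)) (width / 2) - 2 * tol \<le> sign_val sp * increment (real m) x j"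
    and "min (real m / real (period j)) (width / 2) - 2 * tol \<le> sign_val sm * increment (- real m) x j"
    unfolding inc using profile_gain[OF u t0 t2, where sm = sm and sp = sp] by linarith+
qed

text \<open>The factor \<open>sign_val s\<close> reduces both infinities to divergence to plus
  infinity, and \<open>d\<close> is the direction of time.\<close>

lemma filterlim_increment:
  assumes gain: "\<And>m j. real m \<le> real (period j) / 32 \<Longrightarrow>
      min (real m / real (period j)) (width / 2) - 2 * tol \<le> sign_val s * increment (d * real m) x j"
    and d: "\<bar>d\<bar> = 1"
  shows "filterlim (\<lambda>m. \<Sum>j. amp j * increment (d * real m) x j) (signed_infinity s) at_top"
proof -
  have abs: "\<bar>sign_val s * y\<bar> = \<bar>y\<bar>" for y by (cases s) auto
  have "filterlim (\<lambda>m. \<Sum>j. amp j * (sign_val s * increment (d * real m) x j)) at_top at_top"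
  proof (rule tendsto_at_top_of_levels[OF gain])
    fix m j
    have "\<bar>sign_val s * increment (d * real m) x j\<bar> \<le> 4 * width"
      unfolding abs by (rule increment_bound)
    then show "- 4 * width \<le> sign_val s * increment (d * real m) x j" by linarith
    have "\<bar>sign_val s * increment (d * real m) x j\<bar> \<le> 9 * (real m / real (period j))"
      unfolding abs using abs_increment_le[of "d * real m" x j] d by (simp add: abs_mult)
    then show "- 9 * (real m / real (period j)) \<le> sign_val s * increment (d * real m) x j" by linarith
  next
    fix m
    show "summable (\<lambda>j. amp j * (sign_val s * increment (d * real m) x j))"
      using summable_mult[OF summable_increment, of "sign_val s" "d * real m" x]
      by (simp add: ac_simps)
  qed
  moreover have "(\<Sum>j. amp j * (sign_val s * increment (d * real m) x j)) =
      sign_val s * (\<Sum>j. amp j * increment (d * real m) x j)" for m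
    by (subst suminf_mult[OF summable_increment, symmetric]) (simp add: ac_simps)
  ultimately show ?thesis
    by (cases s) (simp_all add: filterlim_uminus_at_bot)
qed

lemma good_imp_div_set:
  assumes "good sm sp x"
  shows "x \<in> div_set sm sp angle cocycle"
proof -
  have "filterlim (\<lambda>m. \<Sum>j. amp j * increment (1 * real m) x j) (signed_infinity sp) at_top"
    by (rule filterlim_increment) (use good_increment(1)[OF assms] in auto)
  then have plus: "filterlim (\<lambda>m. birkhoff_sum angle cocycle (int m) x) (signed_infinity sp) at_top"
    by (simp add: birkhoff_sum_cocycle_eq)
  have "filterlim (\<lambda>m. \<Sum>j. amp j * increment (- 1 * real m) x j) (signed_infinity sm) at_top"
    by (rule filterlim_increment) (use good_increment(2)[OF assms] in auto)
  then have minus: "filterlim (\<lambda>m. birkhoff_sum angle cocycle (- int m) x) (signed_infinity sm) at_top"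
    by (simp add: birkhoff_sum_cocycle_eq)
  \<comment> \<open>The limits along natural times are transferred to integer times, where
    \<open>nat\<close> is inverse to the inclusion on the relevant half-line.\<close>
  have nat: "filterlim nat at_top at_top"
    unfolding filterlim_at_top eventually_at_top_linorder
    by (meson nat_le_iff nat_mono le_nat_iff order_trans of_nat_0_le_iff)
  have "filterlim (\<lambda>m. birkhoff_sum angle cocycle m x) (signed_infinity sp) at_top"
  proof (rule filterlim_cong[THEN iffD1, OF refl refl _ filterlim_compose[OF plus nat]])
    show "eventually (\<lambda>m. birkhoff_sum angle cocycle (int (nat m)) x = birkhoff_sum angle cocycle m x) at_top"
      using eventually_ge_at_top[of 0] by eventually_elim simp
  qed
  moreover have "filterlim (\<lambda>m. birkhoff_sum angle cocycle m x) (signed_infinity sm) at_bot"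
  proof -
    have bound: "\<forall>n \<le> - int Z. Z \<le> nat (- n)" for Z
      by auto
    have "filterlim (\<lambda>m::int. nat (- m)) at_top at_bot"
      unfolding filterlim_at_top eventually_at_bot_linorder
      using bound by blast
    from filterlim_compose[OF minus this]
    show ?thesis
    proof (rule filterlim_cong[THEN iffD1, OF refl refl, rotated])
      show "eventually (\<lambda>m. birkhoff_sum angle cocycle (- int (nat (- m))) x = birkhoff_sum angle cocycle m x) at_bot"
        using eventually_le_at_bot[of 0] by eventually_elim simp
    qed
  qed
  ultimately show ?thesis by (simp add: div_set_def)
qed

section \<open>A Cantor set of good points parametrized by the unit interval\<close>

text \<open>The number of digit blocks of length \<open>n\<close> when place \<open>j\<close> offers
  \<open>base ^ j\<close> choices.\<close>

definition weight :: "nat \<Rightarrow> nat" where "weight n = (\<Prod>j<n. base ^ j)"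

definition prefix :: "real \<Rightarrow> nat \<Rightarrow> int" where "prefix y n = \<lfloor>y * real (weight n)\<rfloor>"

text \<open>The first summand puts every tail near phase \<open>c / 4\<close>; the second is the
  digit of \<open>y\<close> at place \<open>n\<close> in the radix system with bases
  \<open>base ^ n\<close>.\<close>

definition cantor_digit :: "nat \<Rightarrow> real \<Rightarrow> nat \<Rightarrow> int" where
  "cantor_digit c y n = int (c * (period n div 4)) + prefix y (Suc n) mod int (base ^ n)"

definition cantor_point :: "nat \<Rightarrow> real \<Rightarrow> real" where
  "cantor_point c y = radix_tail (cantor_digit c y) 0"

lemma weight_0 [simp]: "weight 0 = 1"
  by (simp add: weight_def)

lemma weight_Suc [simp]: "weight (Suc n) = base ^ n * weight n"
  by (simp add: weight_def mult.commute)

lemma weight_pos [simp]: "weight n > 0"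
  by (simp add: weight_def prod_pos)

lemma prefix_Suc: "prefix y (Suc n) = int (base ^ n) * prefix y n + prefix y (Suc n) mod int (base ^ n)"
proof -
  have "prefix y n = \<lfloor>y * real (weight (Suc n)) / real_of_int (int (base ^ n))\<rfloor>"
    by (simp add: prefix_def)
  also have "\<dots> = prefix y (Suc n) div int (base ^ n)"
    unfolding prefix_def by (rule floor_divide_real_eq_div) simp
  finally show ?thesis by simp
qed

lemma four_dvd_period: "4 dvd period n"
proof -
  have "4 dvd base" by (simp add: base_def)
  also have "base dvd period n" unfolding period_def by (rule dvd_power) simp
  finally show ?thesis .
qed

lemma cantor_digits:
  assumes "c \<le> 3"
  shows "digits (cantor_digit c y)"
proof
  fix n
  have mod: "0 \<le> prefix y (Suc n) mod int (base ^ n)" "prefix y (Suc n) mod int (base ^ n) < int (base ^ n)"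
    by simp_all
  show "0 \<le> cantor_digit c y n" unfolding cantor_digit_def using mod by simp
  have "4 * base ^ n \<le> base ^ 3 * base ^ n" by (intro mult_right_mono) (simp_all add: base_def)
  then have "base ^ n \<le> period n div 4"
    by (simp add: period_def power_add mult.commute less_eq_div_iff_mult_less_eq)
  moreover have "c * (period n div 4) \<le> 3 * (period n div 4)"
    using assms by (rule mult_right_mono) simp
  ultimately have "int (c * (period n div 4)) + int (base ^ n) \<le> int (period n)"
    by linarith
  with mod show "cantor_digit c y n \<le> int (period n)" unfolding cantor_digit_def by linarith
qed

text \<open>Beyond \<open>c / 4\<close> remain the free digit and the next tail, together at most
  \<open>3 * base ^ j\<close> out of \<open>base ^ (j + 3)\<close>.\<close>

lemma radix_tail_cantor_digit:
  assumes "c \<le> 3"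
  shows "real c / 4 \<le> radix_tail (cantor_digit c y) j" "radix_tail (cantor_digit c y) j \<le> real c / 4 + tol"
proof -
  interpret digits "cantor_digit c y" by (rule cantor_digits[OF assms])
  define u where "u = prefix y (Suc j) mod int (base ^ j)"
  have "u < int (base ^ j)" "0 \<le> u" by (simp_all add: u_def)
  then have u: "real_of_int u \<le> real (base ^ j)" "0 \<le> u" by linarith+
  have "real (period j div 4) = real (period j) / 4"
    using four_dvd_period by (simp add: real_of_nat_div)
  then have "real_of_int (cantor_digit c y j) = real c / 4 * real (period j) + of_int u"
    by (simp add: cantor_digit_def u_def)
  then have eq: "radix_tail (cantor_digit c y) j = real c / 4 + (of_int u + radix_tail (cantor_digit c y) (Suc j)) / real (period j)"
    by (subst radix_tail_step) (simp add: add_divide_distrib)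
  have "0 \<le> (of_int u + radix_tail (cantor_digit c y) (Suc j)) / real (period j)"
    using u radix_tail_nonneg[of "Suc j"] by simp
  then show "real c / 4 \<le> radix_tail (cantor_digit c y) j" unfolding eq by linarith
  have "1 \<le> real (base ^ j)" using one_le_power[of base j] by (simp add: base_def)
  then have "of_int u + radix_tail (cantor_digit c y) (Suc j) \<le> 3 * real (base ^ j)"
    using u radix_tail_le_2[of "Suc j"] by linarith
  then have "(of_int u + radix_tail (cantor_digit c y) (Suc j)) / real (period j) \<le> 3 * real (base ^ j) / real (period j)"
    by (rule divide_right_mono) simp
  also have "\<dots> \<le> tol" by (simp add: period_def power_add tol_def base_def)
  finally show "radix_tail (cantor_digit c y) j \<le> real c / 4 + tol" unfolding eq by linarith
qed

lemma quarter_le_3: "quarter sm sp \<le> 3"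
  by (cases sm; cases sp) auto

lemma good_cantor_point: "good sm sp (cantor_point (quarter sm sp) y)"
  unfolding good_def
proof
  fix j
  let ?a = "cantor_digit (quarter sm sp) y"
  interpret digits ?a by (rule cantor_digits[OF quarter_le_3])
  have "real (denom j) * cantor_point (quarter sm sp) y =
      real (quarter sm sp) / 4 + (radix_tail ?a j - real (quarter sm sp) / 4) + of_int (leading ?a j)"
    using denom_mult_radix_tail_0[of j] by (simp add: cantor_point_def)
  moreover have "\<bar>radix_tail ?a j - real (quarter sm sp) / 4\<bar> \<le> tol"
    using radix_tail_cantor_digit[OF quarter_le_3, of sm sp y j] by linarith
  ultimately show "\<exists>n u. \<bar>u\<bar> \<le> tol \<and> real (denom j) * cantor_point (quarter sm sp) y =
      real (quarter sm sp) / 4 + u + of_int n" by blast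
qed

lemma cantor_point_dist:
  assumes "c \<le> 3"
  shows "\<bar>cantor_point c y - cantor_point c y'\<bar> \<le> tol"
  using radix_tail_cantor_digit[OF assms, of y 0] radix_tail_cantor_digit[OF assms, of y' 0]
  unfolding cantor_point_def by linarith

lemma denom_eq: "denom n = base ^ (3 * n) * weight n"
  by (induction n) (auto simp: period_def power_add)

text \<open>The exponent \<open>n * (n + 1) div 2\<close> of the weight outgrows
  \<open>4 * n + 3\<close>, with \<open>base ^ 9\<close> covering small \<open>n\<close>. This
  absorbs the factors by which the Hoelder estimate misses exponent 1/2 at each level.\<close>

lemma weight_growth: "base ^ (4 * n + 3) \<le> base ^ 9 * weight (Suc n)"
proof -
  have weight: "weight (Suc n) = base ^ (n * (n + 1) div 2)" for n
  proof (induction n)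
    case (Suc n)
    have "Suc n * (Suc n + 1) div 2 = Suc n + n * (n + 1) div 2" by simp
    with Suc show ?case by (simp only: weight_Suc[of "Suc n"] power_add)
  qed (simp add: weight_def)
  \<comment> \<open>Expanded, this says \<open>8 * n + 6 \<le> n * (n + 1) + 18\<close>, twice the
    required comparison of exponents.\<close>
  have "0 \<le> (int n - 3) * (int n - 4)"
    by (cases "n \<le> 3") (auto intro: mult_nonpos_nonpos)
  then have "int (2 * (4 * n + 3)) \<le> int (18 + n * (n + 1))" by (simp add: algebra_simps)
  then have "2 * (4 * n + 3) \<le> 18 + n * (n + 1)" by linarith
  then have "2 * (4 * n + 3) div 2 \<le> (18 + n * (n + 1)) div 2" by (rule div_le_mono)
  then have "4 * n + 3 \<le> 9 + n * (n + 1) div 2" by simp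
  then have "base ^ (4 * n + 3) \<le> base ^ (9 + n * (n + 1) div 2)"
    by (rule power_increasing) (simp add: base_def)
  then show ?thesis by (simp only: weight power_add)
qed

text \<open>The index is shifted by two because \<open>weight 0\<close> and \<open>weight 1\<close>
  are both 1.\<close>

lemma weight_unbounded: "n < weight (Suc (Suc n))"
proof -
  have "n < 2 ^ n" by (rule less_exp)
  also have "\<dots> \<le> weight (Suc (Suc n))"
  proof (induction n)
    case (Suc n)
    have "2 \<le> base ^ Suc (Suc n)"
      using power_increasing[of 1 "Suc (Suc n)" base] by (simp add: base_def)
    then have "2 * 2 ^ n \<le> base ^ Suc (Suc n) * weight (Suc (Suc n))"
      using Suc by (rule mult_mono) auto
    then show ?case by (simp only: power_Suc[of 2] weight_Suc[of "Suc (Suc n)"])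
  qed (simp add: base_def)
  finally show ?thesis .
qed

text \<open>At the first place \<open>n\<close> where the digits differ, by \<Delta> say, the
  parameters differ by at most \<open>2 * \<Delta> / weight (Suc n)\<close> and the points by at
  least \<open>\<Delta> / (2 * denom (Suc n))\<close>. With \<open>\<Delta> \<le> base ^ n\<close>,
  \<open>weight_growth\<close> compares the square of the former with the latter.\<close>

lemma cantor_point_holder_less:
  assumes c: "c \<le> 3" and y: "0 \<le> y" "y < y'" "y' < 1"
  shows "(y' - y)\<^sup>2 \<le> 8 * real base ^ 9 * (cantor_point c y' - cantor_point c y)"
proof -
  let ?a = "cantor_digit c y" and ?a' = "cantor_digit c y'"
  interpret a: digits ?a by (rule cantor_digits[OF c])
  interpret a': digits ?a' by (rule cantor_digits[OF c])
  have "\<exists>n. prefix y n \<noteq> prefix y' n"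
  proof -
    obtain k :: nat where "1 / (y' - y) < real k" using reals_Archimedean2 by blast
    then have "1 < real k * (y' - y)" using y by (simp add: field_simps)
    also have "\<dots> \<le> real (weight (Suc (Suc k))) * (y' - y)"
      by (rule mult_right_mono) (use weight_unbounded[of k] y in \<open>simp_all only: of_nat_le_iff less_imp_le le_diff_eq add_0\<close>)
    finally have "prefix y (Suc (Suc k)) < prefix y' (Suc (Suc k))"
      unfolding prefix_def by (simp only: right_diff_distrib mult.commute[of _ "real (weight (Suc (Suc k)))"]) linarith
    then show ?thesis by (metis less_irrefl)
  qed
  moreover have "\<lfloor>y\<rfloor> = 0" "\<lfloor>y'\<rfloor> = 0"
    using y by (simp_all add: floor_eq_iff)
  then have "prefix y 0 = prefix y' 0"
    by (simp add: prefix_def)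
  ultimately obtain n where neq: "prefix y (Suc n) \<noteq> prefix y' (Suc n)"
    and eq: "\<And>i. i \<le> n \<Longrightarrow> prefix y i = prefix y' i"
    using ex_least_nat_less[of "\<lambda>n. prefix y n \<noteq> prefix y' n"] by (metis Suc_eq_plus1)
  define \<Delta> where "\<Delta> = prefix y' (Suc n) - prefix y (Suc n)"
  have "prefix y (Suc n) \<le> prefix y' (Suc n)"
    unfolding prefix_def using y by (intro floor_mono mult_right_mono) auto
  with neq have \<Delta>1: "1 \<le> \<Delta>" by (simp add: \<Delta>_def)
  have digit: "?a' n - ?a n = \<Delta>"
    using prefix_Suc[of y n] prefix_Suc[of y' n] eq[of n] by (simp add: cantor_digit_def \<Delta>_def)
  have "?a j = ?a' j" if "j < n" for j
    using eq[of "Suc j"] that by (simp add: cantor_digit_def)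
  then have "j \<le> n \<Longrightarrow> leading ?a j = leading ?a' j" for j
    by (induction j) auto
  then have "leading ?a' (Suc n) - leading ?a (Suc n) = \<Delta>" using digit by simp
  then have "real (denom (Suc n)) * (cantor_point c y' - cantor_point c y) =
      of_int \<Delta> + (radix_tail ?a' (Suc n) - radix_tail ?a (Suc n))"
    using a.denom_mult_radix_tail_0[of "Suc n"] a'.denom_mult_radix_tail_0[of "Suc n"]
    unfolding cantor_point_def right_diff_distrib by linarith
  moreover have tol: "tol \<le> 1 / 2" by (simp add: tol_def)
  \<comment> \<open>Both tails lie within \<open>tol\<close> above \<open>c / 4\<close>, so later
    digits cannot cancel more than half of \<Delta>.\<close>
  have "\<bar>radix_tail ?a' (Suc n) - radix_tail ?a (Suc n)\<bar> \<le> 1 / 2"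
    using tol radix_tail_cantor_digit[OF c, of y "Suc n"] radix_tail_cantor_digit[OF c, of y' "Suc n"]
    by linarith
  ultimately have point: "of_int \<Delta> / 2 \<le> real (denom (Suc n)) * (cantor_point c y' - cantor_point c y)"
    using \<Delta>1 by linarith
  let ?B = "real (weight (Suc n))"
  \<comment> \<open>Taking floors loses less than 1, which \<open>1 \<le> \<Delta>\<close> absorbs
    into the factor 2.\<close>
  have "?B * (y' - y) \<le> of_int \<Delta> + 1"
    unfolding \<Delta>_def prefix_def by (simp only: right_diff_distrib mult.commute[of ?B]) linarith
  also have "\<dots> \<le> 2 * of_int \<Delta>" using \<Delta>1 by linarith
  finally have "(?B * (y' - y))\<^sup>2 \<le> (2 * of_int \<Delta>)\<^sup>2"
    using y by (intro power_mono) auto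
  also have "\<dots> = 4 * of_int \<Delta> * of_int \<Delta>" by (simp add: power2_eq_square)
  also have "\<Delta> \<le> int (base ^ n)"
  proof -
    have "\<Delta> = prefix y' (Suc n) mod int (base ^ n) - prefix y (Suc n) mod int (base ^ n)"
      using digit by (simp add: cantor_digit_def)
    moreover have "0 < int (base ^ n)" by simp
    note pos_mod_bound[OF this, of "prefix y' (Suc n)"] pos_mod_sign[OF this, of "prefix y (Suc n)"]
    ultimately show ?thesis by linarith
  qed
  then have "real_of_int \<Delta> \<le> real base ^ n"
    by (metis of_int_le_iff of_int_of_nat_eq of_nat_power)
  then have "4 * of_int \<Delta> * of_int \<Delta> \<le> 4 * real base ^ n * real_of_int \<Delta>"
    using \<Delta>1 by (intro mult_right_mono mult_left_mono) auto
  also have "\<dots> \<le> 4 * real base ^ n * (2 * (real (denom (Suc n)) * (cantor_point c y' - cantor_point c y)))"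
    using point by (intro mult_left_mono) auto
  also have "real (denom (Suc n)) = real base ^ (3 * Suc n) * ?B"
    unfolding denom_eq by simp
  also have "4 * real base ^ n * (2 * (real base ^ (3 * Suc n) * ?B * (cantor_point c y' - cantor_point c y))) =
      real (base ^ (4 * n + 3)) * (8 * ?B * (cantor_point c y' - cantor_point c y))"
    by (simp add: power_add[symmetric] mult.assoc[symmetric])
  also have "\<dots> \<le> real (base ^ 9 * weight (Suc n)) * (8 * ?B * (cantor_point c y' - cantor_point c y))"
  proof (rule mult_right_mono)
    have "0 \<le> real (denom (Suc n)) * (cantor_point c y' - cantor_point c y)"
      using point \<Delta>1 by linarith
    then have "0 \<le> cantor_point c y' - cantor_point c y"
      using denom_pos(2)[of "Suc n"] unfolding zero_le_mult_iff by linarith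
    then show "0 \<le> 8 * ?B * (cantor_point c y' - cantor_point c y)"
      by (intro mult_nonneg_nonneg) auto
  qed (use weight_growth of_nat_le_iff in blast)
  finally have "?B\<^sup>2 * (y' - y)\<^sup>2 \<le> ?B\<^sup>2 * (8 * real base ^ 9 * (cantor_point c y' - cantor_point c y))"
    by (simp only: power2_eq_square of_nat_mult of_nat_power ac_simps)
  then show ?thesis
    by (rule mult_left_le_imp_le) (simp only: zero_less_power of_nat_0_less_iff weight_pos)
qed

lemma cantor_point_holder:
  assumes "c \<le> 3" "y \<in> {0..<1}" "y' \<in> {0..<1}"
  shows "(y - y')\<^sup>2 \<le> 8 * real base ^ 9 * \<bar>cantor_point c y - cantor_point c y'\<bar>"
proof -
  have less: "(u - v)\<^sup>2 \<le> 8 * real base ^ 9 * \<bar>cantor_point c u - cantor_point c v\<bar>"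
    if "0 \<le> v" "v < u" "u < 1" for u v
    using cantor_point_holder_less[OF assms(1) that]
    by (rule order_trans) (intro mult_left_mono abs_ge_self, simp)
  consider "y < y'" | "y = y'" | "y' < y" by linarith
  then show ?thesis
  proof cases
    case 1
    then show ?thesis
      using less[of y y'] assms by (simp add: power2_commute abs_minus_commute)
  next
    case 3
    then show ?thesis using less[of y' y] assms by simp
  qed simp
qed

lemma hausdorff_dim_planar_div_set:
  "hausdorff_dim (planar_div_set sm sp angle cocycle) \<ge> ennreal (3 / 2)"
proof (rule hausdorff_dim_polar_ge)
  show "(y - y')\<^sup>2 \<le> 8 * real base ^ 9 *
      \<bar>cantor_point (quarter sm sp) y - cantor_point (quarter sm sp) y'\<bar>"
    if "y \<in> {0..<1}" "y' \<in> {0..<1}" for y y'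
    by (rule cantor_point_holder[OF quarter_le_3 that])
  show "\<bar>cantor_point (quarter sm sp) y - cantor_point (quarter sm sp) y'\<bar> \<le> 1 / 6" for y y'
    using cantor_point_dist[OF quarter_le_3, of sm sp y y'] by (rule order_trans) (simp add: tol_def)
  show "complex_of_real r * cis (2 * pi * cantor_point (quarter sm sp) y) \<in> planar_div_set sm sp angle cocycle"
    if "r \<ge> 1" for r y
    using that good_imp_div_set[OF good_cantor_point, of sm sp y]
    unfolding planar_div_set_def by force
qed simp

theorem mainTheorem8:
  shows "\<exists>(\<alpha>::real) (\<phi>::real \<Rightarrow> real).
    \<alpha> \<notin> \<rat> \<and> circle_fun \<phi> \<and>
    (let f = skew_map \<alpha> \<phi>; P = (\<lambda>s t. planar_div_set s t \<alpha> \<phi>) in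
      homeomorphism UNIV UNIV f (inv f) \<and>
      topologically_transitive f \<and>
      (\<forall>s t. P s t \<noteq> {} \<and> hausdorff_dim (P s t) \<ge> ennreal (3 / 2)) \<and>
      (\<forall>p \<in> P Minus Minus.
         ((\<lambda>n. int_iterate f n p) \<longlongrightarrow> 0) at_bot \<and>
         ((\<lambda>n. int_iterate f n p) \<longlongrightarrow> 0) at_top) \<and>
      (\<forall>p \<in> P Plus Plus. discrete (two_sided_orbit f p)) \<and>
      (\<forall>p \<in> P Minus Plus \<union> P Plus Minus.
         (((\<lambda>n. int_iterate f n p) \<longlongrightarrow> 0) at_bot \<and>
          filterlim (\<lambda>n. int_iterate f n p) at_infinity at_top) \<or>
         (((\<lambda>n. int_iterate f n p) \<longlongrightarrow> 0) at_top \<and>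
          filterlim (\<lambda>n. int_iterate f n p) at_infinity at_bot)))"
proof -
  let ?f = "skew_map angle cocycle" and ?P = "\<lambda>s t. planar_div_set s t angle cocycle"
  have nonempty: "div_set s t angle cocycle \<noteq> {}" for s t
    using good_imp_div_set[OF good_cantor_point] by blast
  have planar_nonempty: "?P s t \<noteq> {}" for s t
  proof -
    obtain x where "x \<in> div_set s t angle cocycle" using nonempty by blast
    then have "complex_of_real 1 * cis (2 * pi * x) \<in> ?P s t"
      unfolding planar_div_set_def using zero_less_one by blast
    then show ?thesis by blast
  qed
  \<comment> \<open>Each sign governs one end of the orbit, so four one-sided statements suffice for
    all four classes.\<close>
  have limit: "((\<lambda>n. int_iterate ?f n p) \<longlongrightarrow> 0) at_bot" if "p \<in> ?P Minus t" for p t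
    using that int_iterate_tendsto_0[OF circle_fun_cocycle]
    by (auto simp: planar_div_set_def div_set_def)
  have limit': "((\<lambda>n. int_iterate ?f n p) \<longlongrightarrow> 0) at_top" if "p \<in> ?P s Minus" for p s
    using that int_iterate_tendsto_0[OF circle_fun_cocycle]
    by (auto simp: planar_div_set_def div_set_def)
  have escape: "filterlim (\<lambda>n. int_iterate ?f n p) at_infinity at_bot" if "p \<in> ?P Plus t" for p t
    using that int_iterate_at_infinity[OF circle_fun_cocycle]
    by (auto simp: planar_div_set_def div_set_def)
  have escape': "filterlim (\<lambda>n. int_iterate ?f n p) at_infinity at_top" if "p \<in> ?P s Plus" for p s
    using that int_iterate_at_infinity[OF circle_fun_cocycle]
    by (auto simp: planar_div_set_def div_set_def)
  show ?thesis
    unfolding Let_def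
  proof (intro exI conjI allI ballI)
    show "angle \<notin> \<rat>" by (rule angle_irrational)
    show "circle_fun cocycle" by (rule circle_fun_cocycle)
    show "homeomorphism UNIV UNIV ?f (inv ?f)"
      by (rule homeomorphism_skew_map[OF circle_fun_cocycle])
    show "topologically_transitive ?f"
      by (rule topologically_transitive_skew_map[OF angle_irrational circle_fun_cocycle nonempty nonempty])
    show "?P s t \<noteq> {}" for s t by (rule planar_nonempty)
    show "hausdorff_dim (?P s t) \<ge> ennreal (3 / 2)" for s t by (rule hausdorff_dim_planar_div_set)
    show "((\<lambda>n. int_iterate ?f n p) \<longlongrightarrow> 0) at_bot" if "p \<in> ?P Minus Minus" for p
      using that by (rule limit)
    show "((\<lambda>n. int_iterate ?f n p) \<longlongrightarrow> 0) at_top" if "p \<in> ?P Minus Minus" for p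
      using that by (rule limit')
    show "discrete (two_sided_orbit ?f p)" if "p \<in> ?P Plus Plus" for p
      using that by (intro discrete_two_sided_orbit escape escape')
    show "((\<lambda>n. int_iterate ?f n p) \<longlongrightarrow> 0) at_bot \<and> filterlim (\<lambda>n. int_iterate ?f n p) at_infinity at_top \<or>
      ((\<lambda>n. int_iterate ?f n p) \<longlongrightarrow> 0) at_top \<and> filterlim (\<lambda>n. int_iterate ?f n p) at_infinity at_bot"
      if "p \<in> ?P Minus Plus \<union> ?P Plus Minus" for p
      using that limit limit' escape escape' by blast
  qed
qed

end
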